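(* For $t \in \{2,3\}$, we have $a_t(n) - b_t(n) \to \infty$ as $n \to \infty$.
   Context: A partition $\lambda=(\lambda_1,\dots,\lambda_\ell)$ of $n\in\mathbb N_0$ is a non-increasing sequence of positive integers (parts) with sum $n$; the empty partition is the only partition of $0$. The Young diagram of $\lambda$ is the left-justified array of boxes with $\lambda_i$ boxes in row $i$. The conjugate $\lambda'$ is the partition whose Young diagram has the columns of $\lambda$ as rows. The hook length of the box in row $i$ and column $j$ of the diagram of $\lambda$ is $h(i,j)=\lambda_i+\lambda'_j-i-j+1$; the number of hooks of length $t$ in $\lambda$ is the number of boxes with hook length exactly $t$. An odd partition is a partition all of whose parts are odd; a distinct partition is a partition whose parts are pairwise distinct. For $t\ge 1$, $a_t(n)$ (respectively $b_t(n)$) denotes the total number of hooks of length $t$ in all odd (respectively distinct) partitions of $n$. *)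

theory Defs
  imports Complex_Main
begin

text \<open>
  A partition is the list of its parts in non-increasing order. Rows, columns and parts are
  numbered from 1 as usual, so the \<open>i\<close>-th part of \<open>lam\<close> is \<open>lam ! (i - 1)\<close>.
\<close>

definition partitions :: "nat \<Rightarrow> nat list set" where
  "partitions n = {lam. sorted_wrt (\<ge>) lam \<and> (\<forall>p\<in>set lam. p > 0) \<and> sum_list lam = n}"

definition part :: "nat list \<Rightarrow> nat \<Rightarrow> nat" where
  "part lam i = lam ! (i - 1)"

definition young_diagram :: "nat list \<Rightarrow> (nat \<times> nat) set" where
  "young_diagram lam = {(i, j). i \<in> {1..length lam} \<and> j \<in> {1..part lam i}}"

text \<open>The number of columns of the diagram is the first, i.e. largest, part.\<close>

definition conjugate :: "nat list \<Rightarrow> nat list" where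
  "conjugate lam =
     map (\<lambda>j. card {i. (i, j) \<in> young_diagram lam})
       [1..<Suc (case lam of [] \<Rightarrow> 0 | p # _ \<Rightarrow> p)]"

text \<open>
  On boxes of the diagram \<open>j \<le> part lam i\<close> and \<open>i \<le> part (conjugate lam) j\<close>, so with the
  summand 1 moved to the front the subtraction on \<open>nat\<close> does not truncate
  (see \<open>hook_length_int\<close> below).
\<close>

definition hook_length :: "nat list \<Rightarrow> nat \<Rightarrow> nat \<Rightarrow> nat" where
  "hook_length lam i j = (part lam i + part (conjugate lam) j + 1) - i - j"

definition hook_count :: "nat \<Rightarrow> nat list \<Rightarrow> nat" where
  "hook_count t lam = card {(i, j) \<in> young_diagram lam. hook_length lam i j = t}"

definition odd_partitions :: "nat \<Rightarrow> nat list set" where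
  "odd_partitions n = {lam \<in> partitions n. \<forall>p\<in>set lam. odd p}"

definition distinct_partitions :: "nat \<Rightarrow> nat list set" where
  "distinct_partitions n = {lam \<in> partitions n. distinct lam}"

definition odd_hooks :: "nat \<Rightarrow> nat \<Rightarrow> nat" where
  "odd_hooks t n = (\<Sum>lam\<in>odd_partitions n. hook_count t lam)"

definition distinct_hooks :: "nat \<Rightarrow> nat \<Rightarrow> nat" where
  "distinct_hooks t n = (\<Sum>lam\<in>distinct_partitions n. hook_count t lam)"

text \<open>
  The sums and cardinalities above range over finite sets, and \<open>conjugate\<close> is the partition
  whose diagram is the transposed one.
\<close>

lemma finite_partitions: "finite (partitions n)"
proof -
  have len: "length lam \<le> sum_list lam" if "\<forall>p\<in>set lam. p > 0" for lam :: "nat list"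
    using that by (induction lam) (auto simp: Suc_le_eq)
  have "partitions n \<subseteq> {lam. set lam \<subseteq> {..n} \<and> length lam \<le> n}"
    using len member_le_sum_list by (fastforce simp: partitions_def)
  then show ?thesis
    using finite_lists_length_le[of "{..n}" n] finite_subset by blast
qed

lemma finite_young_diagram: "finite (young_diagram lam)"
proof -
  have "young_diagram lam = (SIGMA i:{1..length lam}. {1..part lam i})"
    by (auto simp: young_diagram_def)
  then show ?thesis by simp
qed

lemma part_antimono:
  assumes "lam \<in> partitions n" "1 \<le> i" "i \<le> k" "k \<le> length lam"
  shows "part lam k \<le> part lam i"
proof (cases "i = k")
  case False
  then show ?thesis
    using assms sorted_wrt_nth_less[of "(\<ge>)" lam "i - 1" "k - 1"]
    by (auto simp: partitions_def part_def)
qed simp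

lemma column_eq:
  assumes "lam \<in> partitions n"
  shows "{i. (i, j) \<in> young_diagram lam} = {1..card {i. (i, j) \<in> young_diagram lam}}"
proof -
  let ?C = "{i. (i, j) \<in> young_diagram lam}"
  have fin: "finite ?C"
    by (rule finite_subset[of _ "{1..length lam}"]) (auto simp: young_diagram_def)
  have down: "k \<in> ?C" if "i \<in> ?C" "1 \<le> k" "k \<le> i" for i k
    using that part_antimono[OF assms, of k i] by (auto simp: young_diagram_def)
  show ?thesis
  proof (cases "?C = {}")
    case True
    then show ?thesis by simp
  next
    case False
    have "?C = {1..Max ?C}"
    proof (intro set_eqI iffI)
      fix i assume "i \<in> ?C"
      then show "i \<in> {1..Max ?C}"
        using Max_ge[OF fin] by (auto simp: young_diagram_def)
    next
      fix i assume "i \<in> {1..Max ?C}"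
      then show "i \<in> ?C" using down[OF Max_in[OF fin False]] by simp
    qed
    then show ?thesis by (metis card_atLeastAtMost diff_Suc_1)
  qed
qed

lemma length_conjugate: "length (conjugate lam) = (case lam of [] \<Rightarrow> 0 | p # _ \<Rightarrow> p)"
  by (simp add: conjugate_def)

lemma part_conjugate:
  assumes "1 \<le> j" "j \<le> length (conjugate lam)"
  shows "part (conjugate lam) j = card {i. (i, j) \<in> young_diagram lam}"
proof -
  have "[1..<Suc m] ! (j - 1) = j" if "1 \<le> j" "j \<le> m" for m
    using that by (subst nth_upt) auto
  then show ?thesis
    using assms unfolding part_def length_conjugate
    by (simp add: conjugate_def del: upt_Suc)
qed

lemma young_diagram_columns:
  assumes "lam \<in> partitions n" "(i, j) \<in> young_diagram lam"
  shows "1 \<le> j \<and> j \<le> length (conjugate lam)"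
proof -
  have "part lam i \<le> part lam 1"
    using assms part_antimono[OF assms(1), of 1 i] by (auto simp: young_diagram_def)
  then show ?thesis
    using assms(2) by (cases lam) (auto simp: young_diagram_def part_def length_conjugate)
qed

lemma young_diagram_conjugate:
  assumes "lam \<in> partitions n"
  shows "(j, i) \<in> young_diagram (conjugate lam) \<longleftrightarrow> (i, j) \<in> young_diagram lam"
proof (cases "1 \<le> j \<and> j \<le> length (conjugate lam)")
  case True
  then have "(j, i) \<in> young_diagram (conjugate lam) \<longleftrightarrow>
      i \<in> {1..card {i. (i, j) \<in> young_diagram lam}}"
    by (simp add: young_diagram_def[of "conjugate lam"] part_conjugate)
  then show ?thesis using column_eq[OF assms, of j] by blast
next
  case False
  then show ?thesis
    using young_diagram_columns[OF assms] by (auto simp: young_diagram_def[of "conjugate lam"])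
qed

lemma card_young_diagram: "card (young_diagram lam) = sum_list lam"
proof -
  have "young_diagram lam = (SIGMA i:{1..length lam}. {1..part lam i})"
    by (auto simp: young_diagram_def)
  then have "card (young_diagram lam) = (\<Sum>i\<in>{1..length lam}. part lam i)"
    by simp
  also have "\<dots> = (\<Sum>i<length lam. lam ! i)"
    by (rule sum.reindex_bij_witness[of _ Suc "\<lambda>i. i - 1"]) (auto simp: part_def)
  finally show ?thesis by (simp add: sum_list_sum_nth atLeast0LessThan)
qed

lemma conjugate_partition:
  assumes "lam \<in> partitions n"
  shows "conjugate lam \<in> partitions n"
proof -
  have col_fin: "finite {i. (i, j) \<in> young_diagram lam}" for j
    by (rule finite_subset[of _ "{1..length lam}"]) (auto simp: young_diagram_def)
  have "sorted_wrt (\<ge>) (conjugate lam)"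
    unfolding sorted_wrt_iff_nth_less
  proof (intro allI impI)
    fix a b assume ab: "a < b" "b < length (conjugate lam)"
    have "part (conjugate lam) (Suc b) \<le> part (conjugate lam) (Suc a)"
      using ab by (subst (1 2) part_conjugate)
        (auto intro!: card_mono col_fin simp: young_diagram_def)
    then show "conjugate lam ! a \<ge> conjugate lam ! b" by (simp add: part_def)
  qed
  moreover have "p > 0" if p: "p \<in> set (conjugate lam)" for p
  proof -
    obtain a where a: "a < length (conjugate lam)" "p = conjugate lam ! a"
      using p by (auto simp: in_set_conv_nth)
    have "(1, Suc a) \<in> young_diagram lam"
      using a(1) by (cases lam) (auto simp: young_diagram_def part_def length_conjugate)
    then have "card {i. (i, Suc a) \<in> young_diagram lam} > 0"
      using col_fin by (auto simp: card_gt_0_iff)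
    then show ?thesis using a part_conjugate[of "Suc a" lam] by (simp add: part_def)
  qed
  moreover have "sum_list (conjugate lam) = n"
  proof -
    have "bij_betw prod.swap (young_diagram lam) (young_diagram (conjugate lam))"
      by (rule bij_betw_byWitness[of _ prod.swap]) (auto simp: young_diagram_conjugate[OF assms])
    then have "card (young_diagram (conjugate lam)) = card (young_diagram lam)"
      by (metis bij_betw_same_card)
    then show ?thesis using assms by (simp add: card_young_diagram partitions_def)
  qed
  ultimately show ?thesis by (simp add: partitions_def)
qed

lemma hook_length_int:
  assumes "lam \<in> partitions n" "(i, j) \<in> young_diagram lam"
  shows "int (hook_length lam i j) =
    int (part lam i) + int (part (conjugate lam) j) - int i - int j + 1"
proof -
  have "j \<le> part lam i" using assms(2) by (auto simp: young_diagram_def)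
  moreover have "i \<le> part (conjugate lam) j"
    using young_diagram_conjugate[OF assms(1), of j i] assms(2) by (auto simp: young_diagram_def)
  ultimately show ?thesis by (simp add: hook_length_def)
qed

end

theory Submission
  imports Defs "HOL-Library.Multiset" "HOL-Computational_Algebra.Formal_Power_Series"
begin

text \<open>
  The corner of a hook is determined by the size \<open>p\<close> of the part in whose row it lies and by
  the arm length. For hooks of length 2 and 3, whether a part size carries such a hook depends
  only on the multiplicities of \<open>p\<close>, \<open>p - 1\<close> and \<open>p - 2\<close> (\<open>hook_count_2\<close>, \<open>hook_count_3\<close>).
  Both totals thereby become power series, all of them multiples of the series
  \<open>P = (1 + q) (1 + q^2) (1 + q^3) \<dots> = 1 / ((1 - q) (1 - q^3) (1 - q^5) \<dots>)\<close>
  that counts distinct partitions and, by Euler's theorem, odd partitions.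
  For odd partitions the factors are sums and differences of geometric series. For distinct
  partitions one has to sum fractions like \<open>q^p / ((1 + q^p) (1 + q^(p - 1)))\<close> over \<open>p\<close>; these sums telescope,
  except for the number of all parts, \<open>q / (1 + q) + q^2 / (1 + q^2) + \<dots>\<close>.

  The difference of the totals is \<open>(1 - q) P\<close> times an explicit series. The factor
  \<open>(1 - q) P\<close> counts partitions into odd parts other than 1, so its coefficients are nonnegative
  and its constant term is 1. For \<open>t = 2\<close> the explicit series has nonnegative coefficients that
  grow linearly, and this finishes the proof (\<open>hooks_2_diff_ge\<close>).

  For \<open>t = 3\<close> the coefficients of the explicit series involve the number of \<open>p\<close> with odd
  quotient \<open>m div p\<close>. An alternating sum of finitely many terms \<open>m div k\<close> bounds that number
  (\<open>odd_quotients_le\<close>), and the resulting lower bound \<open>bias\<close> of the coefficients is a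
  combination of quotients. It oscillates with the parity of \<open>m\<close> and is often negative, but
  \<open>bias m + bias (m - 3)\<close> adds the values at two arguments of opposite parity, is
  nonnegative for \<open>m \<ge> 8\<close> and grows linearly. To exploit this, the factors \<open>1 / (1 - q^3)\<close> and
  \<open>1 / (1 - q^5)\<close> are moved from the product to the series. The new coefficients
  \<open>bias_3_5\<close> are nonnegative except for the value -1 at 5 and at 7. What remains of the product
  counts partitions into odd parts \<open>\<ge> 7\<close>. Removing one part of such a partition shows that its
  coefficient at \<open>n > 0\<close> is at most the sum of those at \<open>n - k\<close> for odd \<open>k \<ge> 7\<close>, so the two
  negative terms are compensated by the coefficients at \<open>12, 14, 16, \<dots>\<close>, which are large enough
  (\<open>hooks_3_diff_ge\<close>).
\<close>

section \<open>Short hooks in terms of part multiplicities\<close>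

definition rows_ge :: "nat list \<Rightarrow> nat \<Rightarrow> nat" where
  "rows_ge lam x = length (filter (\<lambda>k. x \<le> k) lam)"

lemma le_nth_iff_less_rows_ge:
  assumes "sorted_wrt (\<ge>) lam" "i < length lam"
  shows "x \<le> lam ! i \<longleftrightarrow> i < rows_ge lam x"
  using assms
proof (induction lam arbitrary: i)
  case Nil
  then show ?case by simp
next
  case (Cons y ys)
  have empty: "filter (\<lambda>k. x \<le> k) ys = []" if "\<not> x \<le> y"
    using that Cons.prems(1) by (auto simp: filter_empty_conv)
  show ?case
  proof (cases i)
    case 0
    then show ?thesis using empty by (auto simp: rows_ge_def)
  next
    case (Suc j)
    then show ?thesis
      using Cons.IH[of j] Cons.prems empty by (auto simp: rows_ge_def)
  qed
qed

text \<open>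
  Parts are sorted, so the rows that meet column \<open>x\<close> are the first \<open>rows_ge lam x\<close> ones. This
  translates conditions on row indices into conditions on numbers of parts.
\<close>

lemma le_part_iff:
  assumes "lam \<in> partitions n" "1 \<le> i" "i \<le> length lam"
  shows "x \<le> part lam i \<longleftrightarrow> i \<le> rows_ge lam x"
proof -
  have "i - 1 < length lam" using assms(2,3) by linarith
  then have "x \<le> lam ! (i - 1) \<longleftrightarrow> i - 1 < rows_ge lam x"
    using assms(1) le_nth_iff_less_rows_ge by (simp add: partitions_def)
  moreover have "i - 1 < rows_ge lam x \<longleftrightarrow> i \<le> rows_ge lam x" using assms(2) by linarith
  ultimately show ?thesis by (simp add: Defs.part_def)
qed

lemma rows_ge_le_length: "rows_ge lam x \<le> length lam"
  by (simp add: rows_ge_def)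

lemma part_conjugate_eq_rows_ge:
  assumes "lam \<in> partitions n" "(i, j) \<in> young_diagram lam"
  shows "part (conjugate lam) j = rows_ge lam j"
proof -
  have "1 \<le> j" using assms(2) by (simp add: young_diagram_def)
  then have "{i. (i, j) \<in> young_diagram lam} = {1..rows_ge lam j}"
    using le_part_iff[OF assms(1), of _ j] rows_ge_le_length[of lam j]
    by (auto simp: young_diagram_def)
  then show ?thesis
    using part_conjugate[of j lam] young_diagram_columns[OF assms] by simp
qed

lemma rows_ge_Suc: "rows_ge lam x = count (mset lam) x + rows_ge lam (Suc x)"
  by (induction lam) (auto simp: rows_ge_def)

text \<open>
  A box with hook length \<open>t\<close> is recorded by its arm length \<open>a\<close> and the length \<open>p\<close> of its row. It
  lies in column \<open>p - a\<close>, and since its leg has length \<open>l = t - 1 - a\<close>, it lies in row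
  \<open>rows_ge lam (p - a) - l\<close>; so \<open>a\<close> and \<open>p\<close> determine the box. The two inequalities express
  that this row has length exactly \<open>p\<close>.
\<close>

lemma hook_count_by_arms:
  assumes lam: "lam \<in> partitions n"
  shows "hook_count t lam = (\<Sum>a<t. card {p \<in> set lam. a < p \<and>
    rows_ge lam (p - a) \<le> rows_ge lam p + (t - 1 - a) \<and>
    rows_ge lam (Suc p) + (t - 1 - a) < rows_ge lam (p - a)})" (is "_ = (\<Sum>a<t. card (?P a))")
proof -
  let ?B = "{(i, j) \<in> young_diagram lam. hook_length lam i j = t}"
  let ?f = "\<lambda>(i, j). (part lam i - j, part lam i)"
  let ?g = "\<lambda>(a, p). (rows_ge lam (p - a) - (t - 1 - a), p - a)"
  have diag: "(i, j) \<in> young_diagram lam \<longleftrightarrow> 1 \<le> i \<and> i \<le> length lam \<and> 1 \<le> j \<and> j \<le> part lam i" for i j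
    by (auto simp: young_diagram_def)
  have B: "1 \<le> i \<and> i \<le> length lam \<and> 1 \<le> j \<and> j \<le> part lam i \<and> i \<le> rows_ge lam j \<and>
      (part lam i - j) + (rows_ge lam j - i) + 1 = t" if "(i, j) \<in> ?B" for i j
  proof -
    have ij: "(i, j) \<in> young_diagram lam" "hook_length lam i j = t" using that by auto
    have "i \<le> rows_ge lam j" using ij(1) le_part_iff[OF lam, of i j] by (auto simp: diag)
    moreover have "hook_length lam i j = (part lam i - j) + (rows_ge lam j - i) + 1"
      using ij(1) calculation part_conjugate_eq_rows_ge[OF lam ij(1)] by (auto simp: hook_length_def diag)
    ultimately show ?thesis using ij by (auto simp: diag)
  qed
  have f_in: "?f z \<in> (SIGMA a:{..<t}. ?P a) \<and> ?g (?f z) = z" if z: "z \<in> ?B" for z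
  proof -
    obtain i j where zij: "z = (i, j)" by (cases z)
    note b = B[OF z[unfolded zij]]
    define p where "p = part lam i"
    have p: "p \<in> set lam" using b by (simp add: p_def Defs.part_def less_eq_Suc_le)
    have "i \<le> rows_ge lam p" using b le_part_iff[OF lam, of i p] by (auto simp: p_def)
    moreover have "rows_ge lam (Suc p) < i"
      using b le_part_iff[OF lam, of i "Suc p"] by (auto simp: p_def)
    moreover have "p - (p - j) = j" using b by (auto simp: p_def)
    ultimately show ?thesis using b p by (auto simp: zij simp flip: p_def)
  qed
  have g_in: "?g z \<in> ?B \<and> ?f (?g z) = z" if z: "z \<in> (SIGMA a:{..<t}. ?P a)" for z
  proof -
    obtain a p where zap: "z = (a, p)" by (cases z)
    define i where "i = rows_ge lam (p - a) - (t - 1 - a)"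
    have ap: "a < t" "p \<in> set lam" "a < p" "i \<le> rows_ge lam p" "rows_ge lam (Suc p) < i"
      using z unfolding zap i_def by auto
    have i: "1 \<le> i" "i \<le> length lam" using ap rows_ge_le_length[of lam p] by auto
    have "part lam i = p"
      using ap le_part_iff[OF lam i, of p] le_part_iff[OF lam i, of "Suc p"] by auto
    moreover from this have ij: "(i, p - a) \<in> young_diagram lam" using i ap by (auto simp: diag)
    moreover have "rows_ge lam (p - a) = i + (t - 1 - a)" using i(1) unfolding i_def by linarith
    ultimately have "hook_length lam i (p - a) = t"
      using part_conjugate_eq_rows_ge[OF lam ij] ap by (auto simp: hook_length_def)
    moreover have "?g z = (i, p - a)" by (simp add: zap i_def)
    ultimately show ?thesis using ij ap \<open>part lam i = p\<close> by (simp add: zap)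
  qed
  have "bij_betw ?f ?B (SIGMA a:{..<t}. ?P a)"
  proof (rule bij_betw_byWitness[of _ ?g])
    show "\<forall>z\<in>?B. ?g (?f z) = z" by (rule ballI) (rule f_in[THEN conjunct2])
    show "\<forall>z\<in>(SIGMA a:{..<t}. ?P a). ?f (?g z) = z" by (rule ballI) (rule g_in[THEN conjunct2])
    show "?f ` ?B \<subseteq> (SIGMA a:{..<t}. ?P a)" by (rule image_subsetI) (rule f_in[THEN conjunct1])
    show "?g ` (SIGMA a:{..<t}. ?P a) \<subseteq> ?B" by (rule image_subsetI) (rule g_in[THEN conjunct1])
  qed
  then have "hook_count t lam = card (SIGMA a:{..<t}. ?P a)"
    unfolding hook_count_def by (rule bij_betw_same_card)
  also have "\<dots> = (\<Sum>a<t. card (?P a))" by (rule card_SigmaI) auto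
  finally show ?thesis .
qed

text \<open>
  The summands belong to the arm lengths 0 and 1. With arm length 0 and leg length 1 the corner is
  the last box of the last but one row of length \<open>p\<close>. With arm length 1 and leg length 0 it is the
  last but one box of the last row of length \<open>p\<close>, and no shorter row may reach column \<open>p - 1\<close>.
\<close>

lemma hook_count_2:
  assumes "lam \<in> partitions n"
  shows "hook_count 2 lam = card {p \<in> set lam. 2 \<le> count (mset lam) p}
    + card {p \<in> set lam. 2 \<le> p \<and> p - 1 \<notin> set lam}"
proof -
  have *: "rows_ge lam (p - 1) = count (mset lam) (p - 1) + rows_ge lam p" if "2 \<le> p" for p
    using that rows_ge_Suc[of lam "p - 1"] by (simp add: Suc_diff_le)
  have "{p \<in> set lam. 2 \<le> count (mset lam) p} = {p \<in> set lam. 0 < p \<and>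
    rows_ge lam (p - 0) \<le> rows_ge lam p + (2 - 1 - 0) \<and>
    rows_ge lam (Suc p) + (2 - 1 - 0) < rows_ge lam (p - 0)}" (is "?L = ?R")
  proof -
    have "p \<in> ?L \<longleftrightarrow> p \<in> ?R" for p
      using assms rows_ge_Suc[of lam p] by (auto simp: partitions_def)
    then show ?thesis by blast
  qed
  moreover have "{p \<in> set lam. 2 \<le> p \<and> p - 1 \<notin> set lam} = {p \<in> set lam. 1 < p \<and>
    rows_ge lam (p - 1) \<le> rows_ge lam p + (2 - 1 - 1) \<and>
    rows_ge lam (Suc p) + (2 - 1 - 1) < rows_ge lam (p - 1)}" (is "?L = ?R")
  proof -
    have "p \<in> ?L \<longleftrightarrow> p \<in> ?R" for p
      using *[of p] rows_ge_Suc[of lam p]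
      by (cases "p \<in> set lam \<and> 2 \<le> p") (auto simp: count_mset_0_iff Suc_le_eq)
    then show ?thesis by blast
  qed
  ultimately show ?thesis
    unfolding hook_count_by_arms[OF assms] by (simp add: lessThan_Suc numeral_2_eq_2 numeral_3_eq_3)
qed

text \<open>
  The summands belong to the arm lengths 0, 1 and 2. For arm length 1 exactly one row below the
  corner reaches column \<open>p - 1\<close>: either another row of length \<open>p\<close> and none of length \<open>p - 1\<close>, or
  the only row of length \<open>p - 1\<close>, below the last row of length \<open>p\<close>.
\<close>

lemma hook_count_3:
  assumes "lam \<in> partitions n"
  shows "hook_count 3 lam = card {p \<in> set lam. 3 \<le> count (mset lam) p}
    + card {p \<in> set lam. 2 \<le> p \<and> count (mset lam) (p - 1) \<le> 1 \<and>
        2 \<le> count (mset lam) (p - 1) + count (mset lam) p}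
    + card {p \<in> set lam. 3 \<le> p \<and> p - 1 \<notin> set lam \<and> p - 2 \<notin> set lam}"
proof -
  have *: "rows_ge lam (p - 1) = count (mset lam) (p - 1) + rows_ge lam p" if "2 \<le> p" for p
    using that rows_ge_Suc[of lam "p - 1"] by (simp add: Suc_diff_le)
  have **: "rows_ge lam (p - 2) = count (mset lam) (p - 2) + rows_ge lam (p - 1)" if "3 \<le> p" for p
  proof -
    have "Suc (p - 2) = p - 1" using that by linarith
    then show ?thesis using rows_ge_Suc[of lam "p - 2"] by simp
  qed
  have "{p \<in> set lam. 3 \<le> count (mset lam) p} = {p \<in> set lam. 0 < p \<and>
    rows_ge lam (p - 0) \<le> rows_ge lam p + (3 - 1 - 0) \<and>
    rows_ge lam (Suc p) + (3 - 1 - 0) < rows_ge lam (p - 0)}" (is "?L = ?R")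
  proof -
    have "p \<in> ?L \<longleftrightarrow> p \<in> ?R" for p
      using assms rows_ge_Suc[of lam p] by (auto simp: partitions_def)
    then show ?thesis by blast
  qed
  moreover have "{p \<in> set lam. 2 \<le> p \<and> count (mset lam) (p - 1) \<le> 1 \<and>
        2 \<le> count (mset lam) (p - 1) + count (mset lam) p} = {p \<in> set lam. 1 < p \<and>
    rows_ge lam (p - 1) \<le> rows_ge lam p + (3 - 1 - 1) \<and>
    rows_ge lam (Suc p) + (3 - 1 - 1) < rows_ge lam (p - 1)}" (is "?L = ?R")
  proof -
    have "p \<in> ?L \<longleftrightarrow> p \<in> ?R" for p
      using *[of p] rows_ge_Suc[of lam p]
      by (cases "p \<in> set lam \<and> 2 \<le> p") auto
    then show ?thesis by blast
  qed
  moreover have "{p \<in> set lam. 3 \<le> p \<and> p - 1 \<notin> set lam \<and> p - 2 \<notin> set lam} = {p \<in> set lam. 2 < p \<and>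
    rows_ge lam (p - 2) \<le> rows_ge lam p + (3 - 1 - 2) \<and>
    rows_ge lam (Suc p) + (3 - 1 - 2) < rows_ge lam (p - 2)}" (is "?L = ?R")
  proof -
    have "p \<in> ?L \<longleftrightarrow> p \<in> ?R" for p
      using *[of p] **[of p] rows_ge_Suc[of lam p]
      by (cases "p \<in> set lam \<and> 3 \<le> p") (auto simp: count_mset_0_iff Suc_le_eq)
    then show ?thesis by blast
  qed
  ultimately show ?thesis
    unfolding hook_count_by_arms[OF assms] by (simp add: lessThan_Suc numeral_2_eq_2 numeral_3_eq_3)
qed

section \<open>Generating functions of partitions\<close>

unbundle fps_syntax

text \<open>
  Adding or removing parts is easier on multisets and sets than on sorted lists: partitions with
  parts in \<open>A\<close> are encoded as multisets, distinct partitions as sets.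
\<close>

definition parts_in :: "nat set \<Rightarrow> nat \<Rightarrow> nat multiset set" where
  "parts_in A n = {M. set_mset M \<subseteq> A \<and> \<Sum>\<^sub># M = n}"

definition subsets_with_sum :: "nat set \<Rightarrow> nat \<Rightarrow> nat set set" where
  "subsets_with_sum A n = {S. finite S \<and> S \<subseteq> A \<and> \<Sum>S = n}"

lemma bij_betw_mset_partitions:
  "bij_betw mset (partitions n) (parts_in {0<..} n)"
proof (rule bij_betw_byWitness[of _ "\<lambda>M. rev (sorted_list_of_multiset M)"])
  show "\<forall>lam\<in>partitions n. rev (sorted_list_of_multiset (mset lam)) = lam"
  proof
    fix lam assume "lam \<in> partitions n"
    then have "sorted (rev lam)" by (simp add: partitions_def sorted_wrt_rev)
    then have "sort lam = rev lam" by (metis mset_rev properties_for_sort)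
    then show "rev (sorted_list_of_multiset (mset lam)) = lam" by simp
  qed
  show "(\<lambda>M. rev (sorted_list_of_multiset M)) ` parts_in {0<..} n \<subseteq> partitions n"
  proof clarify
    fix M assume "M \<in> parts_in {0<..} n"
    moreover have "sum_list (sorted_list_of_multiset M) = \<Sum>\<^sub># M"
      by (metis mset_sorted_list_of_multiset sum_mset_sum_list)
    ultimately show "rev (sorted_list_of_multiset M) \<in> partitions n"
      by (auto simp: partitions_def parts_in_def sorted_wrt_rev)
  qed
qed (auto simp: partitions_def parts_in_def sum_mset_sum_list)

lemma bij_betw_mset_odd_partitions:
  "bij_betw mset (odd_partitions n) (parts_in {p. odd p} n)"
proof -
  have "odd_partitions n = {lam \<in> partitions n. set_mset (mset lam) \<subseteq> {p. odd p}}"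
    by (auto simp: odd_partitions_def)
  moreover have "parts_in {p. odd p} n = {M \<in> parts_in {0<..} n. set_mset M \<subseteq> {p. odd p}}"
    by (auto simp: parts_in_def odd_pos)
  moreover have "mset ` {lam \<in> partitions n. set_mset (mset lam) \<subseteq> {p. odd p}} =
      {M \<in> mset ` partitions n. set_mset M \<subseteq> {p. odd p}}"
    by blast
  ultimately show ?thesis
    using bij_betw_mset_partitions[of n] by (simp add: bij_betw_def inj_on_def)
qed

lemma bij_betw_set_distinct_partitions:
  "bij_betw set (distinct_partitions n) (subsets_with_sum {0<..} n)"
proof (rule bij_betw_byWitness[of _ "\<lambda>S. rev (sorted_list_of_set S)"])
  show "\<forall>lam\<in>distinct_partitions n. rev (sorted_list_of_set (set lam)) = lam"
  proof
    fix lam assume "lam \<in> distinct_partitions n"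
    then have "sorted (rev lam)" "distinct lam"
      by (simp_all add: distinct_partitions_def partitions_def sorted_wrt_rev)
    then have "sorted_list_of_set (set (rev lam)) = rev lam"
      by (intro sorted_list_of_set.idem_if_sorted_distinct) auto
    then show "rev (sorted_list_of_set (set lam)) = lam" by simp
  qed
qed (auto simp: distinct_partitions_def partitions_def subsets_with_sum_def distinct_sum_list_conv_Sum
      sorted_wrt_rev)

lemma finite_parts_in:
  assumes "0 \<notin> A"
  shows "finite (parts_in A n)"
proof (rule finite_subset)
  show "parts_in A n \<subseteq> parts_in {0<..} n" using assms by (auto simp: parts_in_def intro: gr0I)
  show "finite (parts_in {0<..} n)"
    using finite_partitions bij_betw_finite[OF bij_betw_mset_partitions] by blast
qed

lemma finite_subsets_with_sum: "finite (subsets_with_sum A n)"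
proof (rule finite_subset)
  show "subsets_with_sum A n \<subseteq> Pow {..n}"
    using member_le_sum[of _ _ "\<lambda>x. x"] by (fastforce simp: subsets_with_sum_def)
qed simp

definition partition_fps :: "nat set \<Rightarrow> int fps" where
  "partition_fps A = Abs_fps (\<lambda>n. int (card (parts_in A n)))"

definition distinct_fps :: "nat set \<Rightarrow> int fps" where
  "distinct_fps A = Abs_fps (\<lambda>n. int (card (subsets_with_sum A n)))"

lemma card_count_ge:
  assumes "p \<in> A"
  shows "card {M \<in> parts_in A n. j \<le> count M p} = (if j * p \<le> n then card (parts_in A (n - j * p)) else 0)"
proof (cases "j * p \<le> n")
  case True
  have "bij_betw (\<lambda>M. M - replicate_mset j p) {M \<in> parts_in A n. j \<le> count M p} (parts_in A (n - j * p))"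
  proof (rule bij_betw_byWitness[of _ "\<lambda>M. M + replicate_mset j p"])
    show "(\<lambda>M. M - replicate_mset j p) ` {M \<in> parts_in A n. j \<le> count M p} \<subseteq> parts_in A (n - j * p)"
    proof clarify
      fix M assume M: "M \<in> parts_in A n" "j \<le> count M p"
      then have "replicate_mset j p \<subseteq># M" by (simp add: count_le_replicate_mset_subset_eq)
      then obtain N where "M = replicate_mset j p + N" by (metis subset_mset.le_iff_add)
      then show "M - replicate_mset j p \<in> parts_in A (n - j * p)"
        using M by (auto simp: parts_in_def sum_mset_replicate_mset)
    qed
  qed (use assms True in \<open>auto simp: parts_in_def count_le_replicate_mset_subset_eq
         sum_mset_replicate_mset split: if_splits\<close>)
  then show ?thesis using True bij_betw_same_card by force
next
  case False
  have "{M \<in> parts_in A n. j \<le> count M p} = {}"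
  proof (rule ccontr)
    assume "{M \<in> parts_in A n. j \<le> count M p} \<noteq> {}"
    then obtain M where M: "M \<in> parts_in A n" "j \<le> count M p" by blast
    then have "replicate_mset j p \<subseteq># M" by (simp add: count_le_replicate_mset_subset_eq)
    then obtain N where "M = replicate_mset j p + N" by (metis subset_mset.le_iff_add)
    then show False using M False by (auto simp: parts_in_def sum_mset_replicate_mset)
  qed
  then show ?thesis using False by (simp only: card.empty if_False)
qed

text \<open>
  Removing \<open>j\<close> copies of \<open>p\<close> is a bijection, so prescribing the minimal multiplicity of a part
  multiplies the series by a power of \<open>X\<close>.
\<close>

lemma partition_fps_count_ge:
  assumes "p \<in> A"
  shows "Abs_fps (\<lambda>n. int (card {M \<in> parts_in A n. j \<le> count M p})) = fps_X ^ (j * p) * partition_fps A"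
  by (rule fps_ext) (auto simp: partition_fps_def card_count_ge[OF assms] fps_X_power_mult_nth)

lemma partition_fps_remove:
  assumes "p \<in> A" "0 \<notin> A"
  shows "partition_fps (A - {p}) = (1 - fps_X ^ p) * partition_fps A"
proof (rule fps_ext)
  fix n
  have "parts_in (A - {p}) n = parts_in A n - {M \<in> parts_in A n. 1 \<le> count M p}"
    by (auto simp: parts_in_def not_in_iff)
  then have "int (card (parts_in (A - {p}) n)) = int (card (parts_in A n)) - int (card {M \<in> parts_in A n. 1 \<le> count M p})"
    by (simp add: card_Diff_subset finite_parts_in[OF assms(2)] of_nat_diff card_mono)
  also have "\<dots> = partition_fps A $ n - (fps_X ^ p * partition_fps A) $ n"
    using partition_fps_count_ge[OF assms(1), of 1] by (simp add: fps_eq_iff) (simp add: partition_fps_def)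
  finally show "partition_fps (A - {p}) $ n = ((1 - fps_X ^ p) * partition_fps A) $ n"
    by (simp add: partition_fps_def algebra_simps)
qed

lemma distinct_fps_with:
  assumes "p \<in> A"
  shows "Abs_fps (\<lambda>n. int (card {S \<in> subsets_with_sum A n. p \<in> S})) = fps_X ^ p * distinct_fps (A - {p})"
proof (rule fps_ext)
  fix n
  have "card {S \<in> subsets_with_sum A n. p \<in> S} = (if p \<le> n then card (subsets_with_sum (A - {p}) (n - p)) else 0)"
  proof (cases "p \<le> n")
    case True
    have ins: "insert p S \<in> {S \<in> subsets_with_sum A n. p \<in> S} \<and> insert p S - {p} = S"
      if "S \<in> subsets_with_sum (A - {p}) (n - p)" for S
    proof -
      have S: "p \<notin> S" "finite S" "S \<subseteq> A" "\<Sum>S = n - p" using that by (auto simp: subsets_with_sum_def)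
      then have "\<Sum>(insert p S) = n" using True by simp
      then show ?thesis using S assms by (simp add: subsets_with_sum_def)
    qed
    have del: "S - {p} \<in> subsets_with_sum (A - {p}) (n - p)" if "S \<in> {S \<in> subsets_with_sum A n. p \<in> S}" for S
      using that by (auto simp: subsets_with_sum_def sum_diff1_nat)
    have "bij_betw (\<lambda>S. S - {p}) {S \<in> subsets_with_sum A n. p \<in> S} (subsets_with_sum (A - {p}) (n - p))"
    proof (rule bij_betw_byWitness[of _ "insert p"])
      show "\<forall>S\<in>{S \<in> subsets_with_sum A n. p \<in> S}. insert p (S - {p}) = S" by (simp add: insert_absorb)
    qed (use ins del in \<open>simp_all add: image_subset_iff\<close>)
    then show ?thesis using True bij_betw_same_card by force
  next
    case False
    have "{S \<in> subsets_with_sum A n. p \<in> S} = {}"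
      using False member_le_sum[of p _ "\<lambda>x. x"] by (fastforce simp: subsets_with_sum_def)
    then show ?thesis using False by (simp only: card.empty if_False)
  qed
  then show "Abs_fps (\<lambda>n. int (card {S \<in> subsets_with_sum A n. p \<in> S})) $ n = (fps_X ^ p * distinct_fps (A - {p})) $ n"
    by (simp add: distinct_fps_def fps_X_power_mult_nth)
qed

lemma distinct_fps_remove:
  assumes "p \<in> A"
  shows "distinct_fps A = (1 + fps_X ^ p) * distinct_fps (A - {p})"
proof (rule fps_ext)
  fix n
  have "subsets_with_sum A n = subsets_with_sum (A - {p}) n \<union> {S \<in> subsets_with_sum A n. p \<in> S}" "subsets_with_sum (A - {p}) n \<inter> {S \<in> subsets_with_sum A n. p \<in> S} = {}"
    by (auto simp: subsets_with_sum_def)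
  then have "card (subsets_with_sum A n) = card (subsets_with_sum (A - {p}) n) + card {S \<in> subsets_with_sum A n. p \<in> S}"
    by (metis (no_types, lifting) card_Un_disjoint finite_subsets_with_sum finite_Un)
  then show "distinct_fps A $ n = ((1 + fps_X ^ p) * distinct_fps (A - {p})) $ n"
    using distinct_fps_with[OF assms] by (simp add: fps_eq_iff algebra_simps) (simp add: distinct_fps_def)
qed

lemma partition_fps_nth_cong:
  assumes "A \<inter> {..n} = B \<inter> {..n}"
  shows "partition_fps A $ n = partition_fps B $ n"
proof -
  have "p \<le> n" if "\<Sum>\<^sub># M = n" "p \<in># M" for M p
    using that by (auto dest: sum_mset.remove)
  then have "parts_in A n = parts_in B n" using assms by (fastforce simp: parts_in_def)
  then show ?thesis by (simp add: partition_fps_def)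
qed

lemma distinct_fps_nth_cong:
  assumes "A \<inter> {..n} = B \<inter> {..n}"
  shows "distinct_fps A $ n = distinct_fps B $ n"
proof -
  have "p \<le> n" if "\<Sum>S = n" "p \<in> S" "finite S" for S p
    using that member_le_sum[of p S "\<lambda>x. x"] by simp
  then have "subsets_with_sum A n = subsets_with_sum B n" using assms by (fastforce simp: subsets_with_sum_def)
  then show ?thesis by (simp add: distinct_fps_def)
qed

lemma partition_fps_empty: "partition_fps {} = 1"
proof (rule fps_ext)
  fix n
  have "parts_in {} n = (if n = 0 then {{#}} else {})" by (auto simp: parts_in_def)
  then show "partition_fps {} $ n = 1 $ n" by (simp add: partition_fps_def)
qed

lemma distinct_fps_empty: "distinct_fps {} = 1"
proof (rule fps_ext)
  fix n
  have "subsets_with_sum {} n = (if n = 0 then {{}} else {})" by (auto simp: subsets_with_sum_def)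
  then show "distinct_fps {} $ n = 1 $ n" by (simp add: distinct_fps_def)
qed

lemma partition_fps_remove_initial:
  assumes "0 \<notin> A" "finite B" "B \<subseteq> A"
  shows "partition_fps (A - B) = (\<Prod>p\<in>B. 1 - fps_X ^ p) * partition_fps A"
  using assms(2,3)
proof (induction B rule: finite_induct)
  case (insert p B)
  have "partition_fps (A - insert p B) = partition_fps ((A - B) - {p})" by (rule arg_cong[of _ _ partition_fps]) auto
  also have "\<dots> = (1 - fps_X ^ p) * partition_fps (A - B)"
    using insert assms(1) by (intro partition_fps_remove) auto
  finally show ?case using insert by (simp add: mult.assoc)
qed simp

lemma distinct_fps_remove_initial:
  assumes "finite B" "B \<subseteq> A"
  shows "distinct_fps A = (\<Prod>p\<in>B. 1 + fps_X ^ p) * distinct_fps (A - B)"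
  using assms
proof (induction B rule: finite_induct)
  case (insert p B)
  have "distinct_fps (A - B) = (1 + fps_X ^ p) * distinct_fps ((A - B) - {p})"
    using insert by (intro distinct_fps_remove) auto
  also have "(A - B) - {p} = A - insert p B" by auto
  finally show ?case using insert by (simp add: mult_ac)
qed simp

text \<open>
  Infinite products of power series are avoided: to compute the coefficient at \<open>n\<close>, finitely many
  factors are split off, and the remaining factor is 1 up to degree \<open>n\<close>.
\<close>

lemma fps_mult_nth_unit:
  fixes f g :: "'a::comm_ring_1 fps"
  assumes "\<And>m. m \<le> n \<Longrightarrow> g $ m = (if m = 0 then 1 else 0)"
  shows "(f * g) $ n = f $ n"
proof -
  have "(f * g) $ n = (\<Sum>i=0..n. if i = n then f $ i else 0)"
    unfolding fps_mult_nth using assms by (intro sum.cong) auto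
  then show ?thesis by simp
qed

text \<open>
  Euler's theorem that odd and distinct partitions are equinumerous. Up to degree \<open>n\<close>, removing
  the even parts \<open>2, 4, \<dots>, 2n\<close> from arbitrary partitions leaves the odd partitions; this
  multiplies the series by all \<open>1 - X^(2k) = (1 + X^k) (1 - X^k)\<close>, and the factors
  \<open>1 - X^k\<close> remove all parts up to \<open>n\<close>.
\<close>

lemma euler_odd_distinct: "partition_fps {p. odd p} = distinct_fps {0<..}"
proof (rule fps_ext)
  fix n :: nat
  let ?odd = "{p. odd p} :: nat set" and ?pos = "{0<..} :: nat set"
  define E where "E = (\<lambda>k. 2 * k) ` {1..n}"
  have partition_fps_odd: "partition_fps ?odd $ n = partition_fps (?pos - E) $ n"
  proof (rule partition_fps_nth_cong, rule set_eqI)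
    fix p
    show "p \<in> ?odd \<inter> {..n} \<longleftrightarrow> p \<in> (?pos - E) \<inter> {..n}"
      by (cases "even p") (auto simp: E_def odd_pos elim!: evenE)
  qed
  have "partition_fps (?pos - E) = (\<Prod>p\<in>E. 1 - fps_X ^ p) * partition_fps ?pos"
    by (rule partition_fps_remove_initial) (auto simp: E_def)
  also have "(\<Prod>p\<in>E. 1 - fps_X ^ p) = (\<Prod>k\<in>{1..n}. 1 - fps_X ^ (2 * k) :: int fps)"
    unfolding E_def by (subst prod.reindex) (auto simp: inj_on_def)
  also have "\<dots> = (\<Prod>k\<in>{1..n}. 1 + fps_X ^ k) * (\<Prod>k\<in>{1..n}. 1 - fps_X ^ k)"
    unfolding prod.distrib[symmetric]
    by (rule prod.cong) (auto simp: algebra_simps mult_2 mult_2_right power_add)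
  also have "\<dots> * partition_fps ?pos = (\<Prod>k\<in>{1..n}. 1 + fps_X ^ k) * partition_fps (?pos - {1..n})"
    by (subst partition_fps_remove_initial) (auto simp: mult.assoc)
  finally have "partition_fps ?odd $ n = ((\<Prod>k\<in>{1..n}. 1 + fps_X ^ k) * partition_fps (?pos - {1..n})) $ n"
    using partition_fps_odd by simp
  also have "\<dots> = (\<Prod>k\<in>{1..n}. 1 + fps_X ^ k :: int fps) $ n"
  proof (rule fps_mult_nth_unit)
    fix m assume "m \<le> n"
    then have "partition_fps (?pos - {1..n}) $ m = partition_fps {} $ m" by (intro partition_fps_nth_cong) auto
    then show "partition_fps (?pos - {1..n}) $ m = (if m = 0 then 1 else 0)" by (simp add: partition_fps_empty)
  qed
  also have "\<dots> = ((\<Prod>k\<in>{1..n}. 1 + fps_X ^ k) * distinct_fps (?pos - {1..n})) $ n"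
  proof (rule fps_mult_nth_unit[symmetric])
    fix m assume "m \<le> n"
    then have "distinct_fps (?pos - {1..n}) $ m = distinct_fps {} $ m" by (intro distinct_fps_nth_cong) auto
    then show "distinct_fps (?pos - {1..n}) $ m = (if m = 0 then 1 else 0)" by (simp add: distinct_fps_empty)
  qed
  also have "(\<Prod>k\<in>{1..n}. 1 + fps_X ^ k) * distinct_fps (?pos - {1..n}) = distinct_fps ?pos"
    by (rule distinct_fps_remove_initial[symmetric]) auto
  finally show "partition_fps ?odd $ n = distinct_fps ?pos $ n" .
qed

section \<open>Infinite sums of power series\<close>

text \<open>
  Meant for families whose member \<open>f p\<close> has no terms of degree less than \<open>p\<close>. Truncating the sum
  at \<open>p \<le> n\<close> then loses nothing from the coefficient at \<open>n\<close>.
\<close>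

definition fps_Sum :: "(nat \<Rightarrow> 'a::comm_ring_1 fps) \<Rightarrow> 'a fps" where
  "fps_Sum f = Abs_fps (\<lambda>n. \<Sum>p\<le>n. f p $ n)"

lemma fps_Sum_nth: "fps_Sum f $ n = (\<Sum>p\<le>n. f p $ n)"
  by (simp add: fps_Sum_def)

lemma mult_fps_Sum:
  assumes "\<And>p n. n < p \<Longrightarrow> f p $ n = 0"
  shows "g * fps_Sum f = fps_Sum (\<lambda>p. g * f p)"
proof (rule fps_ext)
  fix n
  have "(g * fps_Sum f) $ n = (\<Sum>i=0..n. g $ i * (\<Sum>p\<le>n - i. f p $ (n - i)))"
    by (simp add: fps_mult_nth fps_Sum_nth)
  also have "\<dots> = (\<Sum>i=0..n. g $ i * (\<Sum>p\<le>n. f p $ (n - i)))"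
  proof -
    have "(\<Sum>p\<le>n - i. f p $ (n - i)) = (\<Sum>p\<le>n. f p $ (n - i))" for i
      by (rule sum.mono_neutral_left) (auto simp: assms)
    then show ?thesis by simp
  qed
  also have "\<dots> = (\<Sum>p\<le>n. \<Sum>i=0..n. g $ i * f p $ (n - i))"
    unfolding sum_distrib_left by (rule sum.swap)
  finally show "(g * fps_Sum f) $ n = fps_Sum (\<lambda>p. g * f p) $ n"
    by (simp add: fps_mult_nth fps_Sum_nth)
qed

lemma fps_Sum_add: "fps_Sum (\<lambda>p. f p + g p) = fps_Sum f + fps_Sum g"
  by (rule fps_ext) (simp add: fps_Sum_nth sum.distrib)

lemma fps_Sum_diff: "fps_Sum (\<lambda>p. f p - g p) = fps_Sum f - fps_Sum g"
  by (rule fps_ext) (simp add: fps_Sum_nth sum_subtractf)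

text \<open>
  The hypothesis says that \<open>h\<close> converges to \<open>L\<close> fast enough for the truncated sums.
\<close>

lemma fps_Sum_telescope:
  assumes "\<And>n. h (Suc n) $ n = L $ n"
  shows "fps_Sum (\<lambda>p. h (Suc p) - h p) = L - h 0"
proof (rule fps_ext)
  fix n
  have "(\<Sum>p\<le>m. h (Suc p) $ n - h p $ n) = h (Suc m) $ n - h 0 $ n" for m
    by (induction m) auto
  then show "fps_Sum (\<lambda>p. h (Suc p) - h p) $ n = (L - h 0) $ n"
    using assms by (simp add: fps_Sum_nth)
qed

lemma fps_Sum_powers_nth:
  assumes "inj_on g (Collect Q)" "\<And>p. Q p \<Longrightarrow> p \<le> g p"
  shows "fps_Sum (\<lambda>p. if Q p then fps_X ^ g p else 0) $ n =
    (if \<exists>p. Q p \<and> g p = n then 1 else (0::'a::comm_ring_1))"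
proof (cases "\<exists>p. Q p \<and> g p = n")
  case True
  then obtain p where p: "Q p" "g p = n" by blast
  have "(\<Sum>q\<le>n. (if Q q then fps_X ^ g q else 0) $ n) = (\<Sum>q\<le>n. if q = p then 1 else (0::'a))"
    using p assms(1) by (intro sum.cong refl) (auto simp: fps_X_power_nth inj_on_def)
  also have "\<dots> = 1" using assms(2)[OF p(1)] p(2) by simp
  finally show ?thesis using True by (simp add: fps_Sum_nth)
next
  case False
  then have "(if Q q then fps_X ^ g q else 0) $ n = (0::'a)" for q
    by (auto simp: fps_X_power_nth)
  then show ?thesis using False by (simp add: fps_Sum_nth)
qed

lemma one_minus_X_mult_nth:
  "((1 - fps_X) * Abs_fps f) $ n = f n - (if n = 0 then 0 else f (n - 1) :: 'a::comm_ring_1)"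
  by (simp add: algebra_simps left_diff_distrib)

section \<open>Powers along odd numbers\<close>

text \<open>
  The following five identities all say that a sum of powers \<open>X^(g p)\<close> over odd \<open>p\<close>, with
  \<open>p \<ge> 3\<close> in three of them, is \<open>1 - X\<close> times the series whose coefficient at \<open>m\<close> counts the
  exponents up to \<open>m\<close>. These counts are the contributions of the various kinds of hooks in odd
  partitions.
\<close>

lemma powers_odd_ge_3:
  "fps_Sum (\<lambda>p. if odd p \<and> 3 \<le> p then fps_X ^ p else 0) =
    (1 - fps_X) * Abs_fps (\<lambda>m. int ((m - 1) div 2))"
proof (rule fps_ext)
  fix n :: nat
  have "int ((n - 1) div 2) - (if n = 0 then 0 else int ((n - 1 - 1) div 2)) =
      (if odd n \<and> 3 \<le> n then 1 else 0)"
    by presburger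
  then show "fps_Sum (\<lambda>p. if odd p \<and> 3 \<le> p then fps_X ^ p else 0) $ n =
      ((1 - fps_X) * Abs_fps (\<lambda>m. int ((m - 1) div 2))) $ n"
    by (subst fps_Sum_powers_nth) (auto simp: one_minus_X_mult_nth)
qed

lemma powers_double_odd_minus_2:
  "fps_Sum (\<lambda>p. if odd p \<and> 3 \<le> p then fps_X ^ (2 * p - 2) else 0) =
    (1 - fps_X) * Abs_fps (\<lambda>m. int (m div 4))"
proof (rule fps_ext)
  fix n :: nat
  have "(\<exists>p. (odd p \<and> 3 \<le> p) \<and> 2 * p - 2 = n) \<longleftrightarrow> 4 \<le> n \<and> n mod 4 = 0"
    (is "?L \<longleftrightarrow> ?R")
  proof
    show "?L \<Longrightarrow> ?R" by (auto elim!: oddE)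
    show "?R \<Longrightarrow> ?L" by (rule exI[of _ "n div 2 + 1"]) (auto elim!: dvdE simp: mod_eq_0_iff_dvd)
  qed
  moreover have "int (n div 4) - (if n = 0 then 0 else int ((n - 1) div 4)) =
      (if 4 \<le> n \<and> n mod 4 = 0 then 1 else 0)"
    by (cases n) (auto simp: div_Suc dest: dvd_imp_le)
  ultimately show "fps_Sum (\<lambda>p. if odd p \<and> 3 \<le> p then fps_X ^ (2 * p - 2) else 0) $ n =
      ((1 - fps_X) * Abs_fps (\<lambda>m. int (m div 4))) $ n"
    by (subst fps_Sum_powers_nth) (auto simp: one_minus_X_mult_nth inj_on_def)
qed

lemma powers_double_odd_ge_3:
  "fps_Sum (\<lambda>p. if odd p \<and> 3 \<le> p then fps_X ^ (2 * p) else 0) =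
    (1 - fps_X) * Abs_fps (\<lambda>m. int ((m - 2) div 4))"
proof (rule fps_ext)
  fix n :: nat
  have "(\<exists>p. (odd p \<and> 3 \<le> p) \<and> 2 * p = n) \<longleftrightarrow> 6 \<le> n \<and> n mod 4 = 2"
    by presburger
  moreover have "int ((n - 2) div 4) - (if n = 0 then 0 else int ((n - 1 - 2) div 4)) =
      (if 6 \<le> n \<and> n mod 4 = 2 then 1 else 0)"
  proof (cases "n < 3")
    case False
    then have "n = Suc (n - 3) + 2" by simp
    then obtain k where "n = Suc k + 2" ..
    then show ?thesis by (auto simp: div_Suc mod_Suc)
  qed auto
  ultimately show "fps_Sum (\<lambda>p. if odd p \<and> 3 \<le> p then fps_X ^ (2 * p) else 0) $ n =
      ((1 - fps_X) * Abs_fps (\<lambda>m. int ((m - 2) div 4))) $ n"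
    by (subst fps_Sum_powers_nth) (auto simp: one_minus_X_mult_nth inj_on_def)
qed

lemma powers_double_odd:
  "fps_Sum (\<lambda>p. if odd p then fps_X ^ (2 * p) else 0) =
    (1 - fps_X) * Abs_fps (\<lambda>m. int ((m + 2) div 4))"
proof (rule fps_ext)
  fix n :: nat
  have "(\<exists>p. odd p \<and> 2 * p = n) \<longleftrightarrow> n mod 4 = 2"
    by presburger
  moreover have "int ((n + 2) div 4) - (if n = 0 then 0 else int ((n - 1 + 2) div 4)) =
      (if n mod 4 = 2 then 1 else 0)"
  proof (cases n)
    case (Suc k)
    have "(Suc k + 2) div 4 = (k + 2) div 4 + (if Suc k mod 4 = 2 then 1 else 0)" by presburger
    then show ?thesis by (simp add: Suc)
  qed simp
  ultimately show "fps_Sum (\<lambda>p. if odd p then fps_X ^ (2 * p) else 0) $ n =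
      ((1 - fps_X) * Abs_fps (\<lambda>m. int ((m + 2) div 4))) $ n"
    by (subst fps_Sum_powers_nth) (auto simp: one_minus_X_mult_nth inj_on_def)
qed

lemma powers_triple_odd:
  "fps_Sum (\<lambda>p. if odd p then fps_X ^ (3 * p) else 0) =
    (1 - fps_X) * Abs_fps (\<lambda>m. int ((m + 3) div 6))"
proof (rule fps_ext)
  fix n :: nat
  have "(\<exists>p. odd p \<and> 3 * p = n) \<longleftrightarrow> n mod 6 = 3"
    by presburger
  moreover have "int ((n + 3) div 6) - (if n = 0 then 0 else int ((n - 1 + 3) div 6)) =
      (if n mod 6 = 3 then 1 else 0)"
  proof (cases n)
    case (Suc k)
    have "(Suc k + 3) div 6 = (k + 3) div 6 + (if Suc k mod 6 = 3 then 1 else 0)" by presburger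
    then show ?thesis by (simp add: Suc)
  qed simp
  ultimately show "fps_Sum (\<lambda>p. if odd p then fps_X ^ (3 * p) else 0) $ n =
      ((1 - fps_X) * Abs_fps (\<lambda>m. int ((m + 3) div 6))) $ n"
    by (subst fps_Sum_powers_nth) (auto simp: one_minus_X_mult_nth inj_on_def)
qed

section \<open>Hook totals as sums over part sizes\<close>

lemma sum_card_swap:
  fixes n :: nat
  assumes "finite I" "\<And>x. x \<in> I \<Longrightarrow> E x \<subseteq> {..n}"
  shows "(\<Sum>x\<in>I. card {p \<in> E x. Q x p}) = (\<Sum>p\<le>n. card {x \<in> I. p \<in> E x \<and> Q x p})"
proof -
  have "(\<Sum>x\<in>I. card {p \<in> E x. Q x p}) = (\<Sum>x\<in>I. \<Sum>p\<le>n. if p \<in> E x \<and> Q x p then 1 else 0)"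
  proof (rule sum.cong[OF refl])
    fix x assume "x \<in> I"
    then have "{..n} \<inter> {p \<in> E x. Q x p} = {p \<in> E x. Q x p}" using assms(2) by auto
    moreover have "(\<Sum>p\<le>n. if p \<in> E x \<and> Q x p then 1 else 0) = card ({..n} \<inter> {p \<in> E x. Q x p})"
      by (simp add: sum.If_cases)
    ultimately show "card {p \<in> E x. Q x p} = (\<Sum>p\<le>n. if p \<in> E x \<and> Q x p then 1 else 0)"
      by simp
  qed
  also have "\<dots> = (\<Sum>p\<le>n. \<Sum>x\<in>I. if p \<in> E x \<and> Q x p then 1 else 0)" by (rule sum.swap)
  also have "\<dots> = (\<Sum>p\<le>n. card {x \<in> I. p \<in> E x \<and> Q x p})"
    using assms(1) by (simp add: sum.If_cases Int_def)
  finally show ?thesis .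
qed

lemma sum_odd_partitions:
  "(\<Sum>lam\<in>odd_partitions n. card {p \<in> set lam. Q (mset lam) p}) =
    (\<Sum>p\<le>n. card {M \<in> parts_in {p. odd p} n. p \<in># M \<and> Q M p})"
proof -
  have "(\<Sum>lam\<in>odd_partitions n. card {p \<in> set lam. Q (mset lam) p}) =
      (\<Sum>M\<in>parts_in {p. odd p} n. card {p \<in> set_mset M. Q M p})"
    using sum.reindex_bij_betw[OF bij_betw_mset_odd_partitions, of "\<lambda>M. card {p \<in> set_mset M. Q M p}"]
    by simp
  also have "\<dots> = (\<Sum>p\<le>n. card {M \<in> parts_in {p. odd p} n. p \<in> set_mset M \<and> Q M p})"
    by (rule sum_card_swap, simp add: finite_parts_in) (auto simp: parts_in_def dest: sum_mset.remove)
  finally show ?thesis .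
qed

lemma sum_distinct_partitions:
  "(\<Sum>lam\<in>distinct_partitions n. card {p \<in> set lam. Q (set lam) p}) =
    (\<Sum>p\<le>n. card {S \<in> subsets_with_sum {0<..} n. p \<in> S \<and> Q S p})"
proof -
  have "(\<Sum>lam\<in>distinct_partitions n. card {p \<in> set lam. Q (set lam) p}) =
      (\<Sum>S\<in>subsets_with_sum {0<..} n. card {p \<in> S. Q S p})"
    using sum.reindex_bij_betw[OF bij_betw_set_distinct_partitions, of "\<lambda>S. card {p \<in> S. Q S p}"]
    by simp
  also have "\<dots> = (\<Sum>p\<le>n. card {S \<in> subsets_with_sum {0<..} n. p \<in> S \<and> Q S p})"
    by (rule sum_card_swap[OF finite_subsets_with_sum]) (use member_le_sum[of _ _ "\<lambda>x. x"] in \<open>auto simp: subsets_with_sum_def\<close>)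
  finally show ?thesis .
qed

section \<open>Hooks in odd partitions\<close>

abbreviation "Pos \<equiv> {0<..} :: nat set"
abbreviation "Odd \<equiv> {p. odd p} :: nat set"

text \<open>
  In an odd partition \<open>p - 1\<close> is never a part. Hence a part size carries a hook of length 2 with
  arm length 0 if it is repeated, and one with arm length 1 if it is at least 3.
\<close>

lemma odd_hooks_2_fps:
  "Abs_fps (\<lambda>n. int (odd_hooks 2 n)) = (1 - fps_X) * partition_fps Odd *
    Abs_fps (\<lambda>m. int ((m + 2) div 4) + int ((m - 1) div 2))"
proof -
  let ?k = "\<lambda>p. (if odd p then fps_X ^ (2 * p) else 0) + (if odd p \<and> 3 \<le> p then fps_X ^ p else 0) :: int fps"
  have "Abs_fps (\<lambda>n. int (odd_hooks 2 n)) = fps_Sum (\<lambda>p. partition_fps Odd * ?k p)"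
  proof (rule fps_ext)
    fix n
    have "odd_hooks 2 n = (\<Sum>lam\<in>odd_partitions n. card {p \<in> set lam. 2 \<le> count (mset lam) p}
        + card {p \<in> set lam. 3 \<le> p})"
      unfolding odd_hooks_def
    proof (rule sum.cong[OF refl])
      fix lam assume lam: "lam \<in> odd_partitions n"
      have "2 \<le> p \<and> p - 1 \<notin> set lam \<longleftrightarrow> 3 \<le> p" if "p \<in> set lam" for p
      proof -
        have "odd p" using lam that by (auto simp: odd_partitions_def)
        then have "2 \<le> p \<longleftrightarrow> 3 \<le> p" "even (p - 1)" by presburger+
        moreover from this have "p - 1 \<notin> set lam" using lam by (auto simp only: odd_partitions_def mem_Collect_eq)
        ultimately show ?thesis by blast
      qed
      then have "{p \<in> set lam. 2 \<le> p \<and> p - 1 \<notin> set lam} = {p \<in> set lam. 3 \<le> p}" by blast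
      then show "hook_count 2 lam = card {p \<in> set lam. 2 \<le> count (mset lam) p} + card {p \<in> set lam. 3 \<le> p}"
        using hook_count_2[of lam n] lam by (simp add: odd_partitions_def)
    qed
    also have "\<dots> = (\<Sum>p\<le>n. card {M \<in> parts_in Odd n. p \<in># M \<and> 2 \<le> count M p}
        + card {M \<in> parts_in Odd n. p \<in># M \<and> 3 \<le> p})"
      using sum_odd_partitions[of "\<lambda>M p. 2 \<le> count M p" n] sum_odd_partitions[of "\<lambda>M p. 3 \<le> p" n]
      by (simp add: sum.distrib)
    finally have "int (odd_hooks 2 n) = (\<Sum>p\<le>n. int (card {M \<in> parts_in Odd n. p \<in># M \<and> 2 \<le> count M p})
        + int (card {M \<in> parts_in Odd n. p \<in># M \<and> 3 \<le> p}))"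
      by simp
    also have "\<dots> = (\<Sum>p\<le>n. (partition_fps Odd * ?k p) $ n)"
    proof (rule sum.cong[OF refl])
      fix p
      show "int (card {M \<in> parts_in Odd n. p \<in># M \<and> 2 \<le> count M p}) + int (card {M \<in> parts_in Odd n. p \<in># M \<and> 3 \<le> p})
          = (partition_fps Odd * ?k p) $ n"
      proof (cases "odd p")
        case True
        have "{M \<in> parts_in Odd n. p \<in># M \<and> 2 \<le> count M p} = {M \<in> parts_in Odd n. 2 \<le> count M p}"
          by (auto simp flip: count_greater_zero_iff)
        moreover have "{M \<in> parts_in Odd n. p \<in># M \<and> 3 \<le> p} = (if 3 \<le> p then {M \<in> parts_in Odd n. 1 \<le> count M p} else {})"
          by (auto simp flip: count_greater_zero_iff)
        ultimately show ?thesis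
          using True partition_fps_count_ge[of p Odd 2] partition_fps_count_ge[of p Odd 1]
          by (simp add: fps_eq_iff distrib_left mult.commute)
      next
        case False
        then have "p \<notin># M" if "M \<in> parts_in Odd n" for M using that by (auto simp: parts_in_def)
        then have "{M \<in> parts_in Odd n. p \<in># M \<and> 2 \<le> count M p} = {}" "{M \<in> parts_in Odd n. p \<in># M \<and> 3 \<le> p} = {}"
          by blast+
        then show ?thesis using False by (simp only: card.empty) simp
      qed
    qed
    finally show "Abs_fps (\<lambda>n. int (odd_hooks 2 n)) $ n = fps_Sum (\<lambda>p. partition_fps Odd * ?k p) $ n"
      by (simp only: fps_Sum_nth fps_nth_Abs_fps)
  qed
  also have "\<dots> = partition_fps Odd * fps_Sum ?k"
    by (rule mult_fps_Sum[symmetric]) (auto simp: fps_X_power_nth)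
  also have "fps_Sum ?k = (1 - fps_X) * (Abs_fps (\<lambda>m. int ((m + 2) div 4)) + Abs_fps (\<lambda>m. int ((m - 1) div 2)))"
    by (simp only: fps_Sum_add powers_double_odd powers_odd_ge_3 distrib_left)
  finally show ?thesis by (simp add: mult_ac fps_plus_def)
qed

text \<open>
  The four quotients come from the arm lengths: part sizes occurring at least three times (arm
  length 0), part sizes \<open>p \<ge> 3\<close> occurring at least twice (arm length 1), and part sizes \<open>p \<ge> 3\<close>
  such that \<open>p - 2\<close> is not a part (arm length 2). The last kind is counted by \<open>X^p\<close> minus
  \<open>X^p X^(p - 2)\<close>.
\<close>

lemma odd_hooks_3_fps:
  "Abs_fps (\<lambda>n. int (odd_hooks 3 n)) = (1 - fps_X) * partition_fps Odd *
    Abs_fps (\<lambda>m. int ((m + 3) div 6) + int ((m - 2) div 4) + int ((m - 1) div 2) - int (m div 4))"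
proof -
  let ?d = "\<lambda>p. (if odd p then fps_X ^ (3 * p) else 0) :: int fps"
    and ?c = "\<lambda>p. (if odd p \<and> 3 \<le> p then fps_X ^ (2 * p) else 0) :: int fps"
    and ?a = "\<lambda>p. (if odd p \<and> 3 \<le> p then fps_X ^ p else 0) :: int fps"
    and ?b = "\<lambda>p. (if odd p \<and> 3 \<le> p then fps_X ^ (2 * p - 2) else 0) :: int fps"
  let ?k = "\<lambda>p. ?d p + ?c p + ?a p - ?b p"
  have "Abs_fps (\<lambda>n. int (odd_hooks 3 n)) = fps_Sum (\<lambda>p. partition_fps Odd * ?k p)"
  proof (rule fps_ext)
    fix n
    let ?A = "\<lambda>M p. 3 \<le> count M p" and ?B = "\<lambda>M p. 3 \<le> p \<and> 2 \<le> count M p"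
      and ?C = "\<lambda>M p. 3 \<le> p \<and> p - 2 \<notin># M"
    have "odd_hooks 3 n = (\<Sum>lam\<in>odd_partitions n. card {p \<in> set lam. ?A (mset lam) p}
        + card {p \<in> set lam. ?B (mset lam) p} + card {p \<in> set lam. ?C (mset lam) p})"
      unfolding odd_hooks_def
    proof (rule sum.cong[OF refl])
      fix lam assume lam: "lam \<in> odd_partitions n"
      have p: "(2 \<le> p \<longleftrightarrow> 3 \<le> p) \<and> p - 1 \<notin> set lam" if "p \<in> set lam" for p
      proof -
        have "odd p" using lam that by (auto simp: odd_partitions_def)
        then have "2 \<le> p \<longleftrightarrow> 3 \<le> p" "even (p - 1)" by presburger+
        moreover from this have "p - 1 \<notin> set lam" using lam by (auto simp only: odd_partitions_def mem_Collect_eq)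
        ultimately show ?thesis by blast
      qed
      then have "{p \<in> set lam. 2 \<le> p \<and> count (mset lam) (p - 1) \<le> 1 \<and>
        2 \<le> count (mset lam) (p - 1) + count (mset lam) p} = {p \<in> set lam. ?B (mset lam) p}"
        by (auto simp flip: count_mset_0_iff)
      moreover have "{p \<in> set lam. 3 \<le> p \<and> p - 1 \<notin> set lam \<and> p - 2 \<notin> set lam} = {p \<in> set lam. ?C (mset lam) p}"
        using p by auto
      ultimately show "hook_count 3 lam = card {p \<in> set lam. ?A (mset lam) p}
        + card {p \<in> set lam. ?B (mset lam) p} + card {p \<in> set lam. ?C (mset lam) p}"
        using hook_count_3[of lam n] lam by (simp add: odd_partitions_def)
    qed
    also have "\<dots> = (\<Sum>p\<le>n. card {M \<in> parts_in Odd n. p \<in># M \<and> ?A M p}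
        + card {M \<in> parts_in Odd n. p \<in># M \<and> ?B M p} + card {M \<in> parts_in Odd n. p \<in># M \<and> ?C M p})"
      using sum_odd_partitions[of ?A n] sum_odd_partitions[of ?B n] sum_odd_partitions[of ?C n]
      by (simp add: sum.distrib)
    finally have "int (odd_hooks 3 n) = (\<Sum>p\<le>n. int (card {M \<in> parts_in Odd n. p \<in># M \<and> ?A M p})
        + int (card {M \<in> parts_in Odd n. p \<in># M \<and> ?B M p}) + int (card {M \<in> parts_in Odd n. p \<in># M \<and> ?C M p}))"
      by simp
    also have "\<dots> = (\<Sum>p\<le>n. (partition_fps Odd * ?k p) $ n)"
    proof (rule sum.cong[OF refl])
      fix p
      show "int (card {M \<in> parts_in Odd n. p \<in># M \<and> ?A M p}) + int (card {M \<in> parts_in Odd n. p \<in># M \<and> ?B M p})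
          + int (card {M \<in> parts_in Odd n. p \<in># M \<and> ?C M p}) = (partition_fps Odd * ?k p) $ n"
      proof (cases "odd p")
        case True
        have A: "{M \<in> parts_in Odd n. p \<in># M \<and> ?A M p} = {M \<in> parts_in Odd n. 3 \<le> count M p}"
          by (auto simp flip: count_greater_zero_iff)
        show ?thesis
        proof (cases "3 \<le> p")
          case p: True
          have B: "{M \<in> parts_in Odd n. p \<in># M \<and> ?B M p} = {M \<in> parts_in Odd n. 2 \<le> count M p}"
            using p by (auto simp flip: count_greater_zero_iff)
          have C: "{M \<in> parts_in Odd n. p \<in># M \<and> ?C M p} = {M \<in> parts_in (Odd - {p - 2}) n. 1 \<le> count M p}"
            using p by (auto simp: parts_in_def simp flip: count_greater_zero_iff)
          have "odd (p - 2)" using True p by simp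
          then have rem: "partition_fps (Odd - {p - 2}) = (1 - fps_X ^ (p - 2)) * partition_fps Odd" by (intro partition_fps_remove) auto
          have "fps_X ^ p * partition_fps (Odd - {p - 2}) = partition_fps Odd * (fps_X ^ p - fps_X ^ p * fps_X ^ (p - 2))"
            unfolding rem by (simp add: algebra_simps)
          moreover have "p + (p - 2) = 2 * p - 2" using p by simp
          ultimately have "fps_X ^ p * partition_fps (Odd - {p - 2}) = partition_fps Odd * (fps_X ^ p - fps_X ^ (2 * p - 2))"
            by (simp flip: power_add)
          moreover have "p \<in> Odd - {p - 2}" using True p by auto
          ultimately have "int (card {M \<in> parts_in Odd n. p \<in># M \<and> ?C M p}) =
              (partition_fps Odd * (fps_X ^ p - fps_X ^ (2 * p - 2))) $ n"
            unfolding C using partition_fps_count_ge[of p "Odd - {p - 2}" 1] by (simp add: fps_eq_iff)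
          then show ?thesis
            unfolding A B
            using True p partition_fps_count_ge[of p Odd 3] partition_fps_count_ge[of p Odd 2]
            by (simp add: fps_eq_iff algebra_simps)
        next
          case p: False
          have "{M \<in> parts_in Odd n. p \<in># M \<and> ?B M p} = {}" "{M \<in> parts_in Odd n. p \<in># M \<and> ?C M p} = {}"
            using p by auto
          then show ?thesis
            unfolding A using True p partition_fps_count_ge[of p Odd 3]
            by (simp only: card.empty) (simp add: fps_eq_iff mult.commute)
        qed
      next
        case False
        then have "p \<notin># M" if "M \<in> parts_in Odd n" for M using that by (auto simp: parts_in_def)
        then have "{M \<in> parts_in Odd n. p \<in># M \<and> ?A M p} = {}" "{M \<in> parts_in Odd n. p \<in># M \<and> ?B M p} = {}"
            "{M \<in> parts_in Odd n. p \<in># M \<and> ?C M p} = {}"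
          by blast+
        then show ?thesis using False by (simp only: card.empty) simp
      qed
    qed
    finally show "Abs_fps (\<lambda>n. int (odd_hooks 3 n)) $ n = fps_Sum (\<lambda>p. partition_fps Odd * ?k p) $ n"
      by (simp only: fps_Sum_nth fps_nth_Abs_fps)
  qed
  also have "\<dots> = partition_fps Odd * fps_Sum ?k"
    by (rule mult_fps_Sum[symmetric]) (auto simp: fps_X_power_nth)
  also have "fps_Sum ?k = (1 - fps_X) * (Abs_fps (\<lambda>m. int ((m + 3) div 6)) + Abs_fps (\<lambda>m. int ((m - 2) div 4))
      + Abs_fps (\<lambda>m. int ((m - 1) div 2)) - Abs_fps (\<lambda>m. int (m div 4)))"
    by (simp only: fps_Sum_add fps_Sum_diff powers_odd_ge_3 powers_double_odd_minus_2 powers_double_odd_ge_3 powers_triple_odd distrib_left right_diff_distrib)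
  finally show ?thesis by (simp add: mult_ac fps_plus_def fps_minus_def)
qed

section \<open>Hooks in distinct partitions\<close>

lemma distinct_fps_with_without:
  assumes "p \<in> A" "p \<notin> B"
  shows "int (card {S \<in> subsets_with_sum A n. p \<in> S \<and> S \<inter> B = {}}) = (fps_X ^ p * distinct_fps (A - insert p B)) $ n"
proof -
  have "{S \<in> subsets_with_sum A n. p \<in> S \<and> S \<inter> B = {}} = {S \<in> subsets_with_sum (A - B) n. p \<in> S}"
    by (auto simp: subsets_with_sum_def)
  moreover have "A - insert p B = A - B - {p}" by auto
  ultimately show ?thesis
    using distinct_fps_with[of p "A - B"] assms by (simp add: fps_eq_iff)
qed

text \<open>
  Counts pairs of a distinct partition and a part \<open>p \<ge> 2\<close> of it such that \<open>p - 1\<close> is not a part.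
\<close>

definition gap1_fps :: "int fps" where
  "gap1_fps = fps_Sum (\<lambda>p. if 2 \<le> p then fps_X ^ p * distinct_fps (Pos - {p, p - 1}) else 0)"

text \<open>
  Counts pairs of a distinct partition and a part \<open>p \<ge> 3\<close> of it such that neither \<open>p - 1\<close> nor
  \<open>p - 2\<close> is a part.
\<close>

definition gap2_fps :: "int fps" where
  "gap2_fps = fps_Sum (\<lambda>p. if 3 \<le> p then fps_X ^ p * distinct_fps (Pos - {p, p - 1, p - 2}) else 0)"

lemma X_power_mult_nth_less: "n < p \<Longrightarrow> (fps_X ^ p * f) $ n = (0::'a::comm_ring_1)"
  by (simp add: fps_X_power_mult_nth)

lemma one_minus_X_power_nonzero:
  assumes "p > 0"
  shows "1 - fps_X ^ p \<noteq> (0 :: int fps)"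
proof
  assume "1 - fps_X ^ p = (0 :: int fps)"
  then have "(1 - fps_X ^ p) $ 0 = (0 :: int)" by (simp only: fps_zero_nth)
  then show False using assms by simp
qed

text \<open>
  With \<open>Z\<close> the series of distinct partitions avoiding \<open>p\<close> and \<open>p - 1\<close>, those required
  to avoid just \<open>p\<close> have the series \<open>(1 + X^(p - 1)) Z\<close>, and just \<open>p - 1\<close>, \<open>(1 + X^p) Z\<close>.
  Their difference is \<open>(X^(p - 1) - X^p) Z\<close>, so that \<open>(1 - X) X^p Z\<close> is \<open>X\<close> times a difference of
  consecutive terms and the sum over \<open>p\<close> telescopes.
\<close>

lemma gap1_fps_eq: "(1 - fps_X ^ 2) * gap1_fps = fps_X ^ 2 * distinct_fps Pos"
proof -
  (* The maximum makes h constant up to 2, so that the sum starts at p = 2. The factor X makes up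
     for the fact that h (Suc n) still forbids the part n. *)
  define h where "h p = fps_X * distinct_fps (Pos - {max p 2 - 1})" for p
  have "(1 - fps_X) * (fps_X ^ p * distinct_fps (Pos - {p, p - 1})) = h (Suc p) - h p" if "2 \<le> p" for p
  proof -
    obtain q where q: "p = Suc q" "q > 0" using \<open>2 \<le> p\<close> by (cases p) auto
    have "distinct_fps (Pos - {p}) = (1 + fps_X ^ q) * distinct_fps (Pos - {p} - {q})"
      by (rule distinct_fps_remove) (use q in auto)
    moreover have "distinct_fps (Pos - {q}) = (1 + fps_X ^ p) * distinct_fps (Pos - {q} - {p})"
      by (rule distinct_fps_remove) (use q in auto)
    moreover have "Pos - {p} - {q} = Pos - {p, p - 1}" "Pos - {q} - {p} = Pos - {p, p - 1}"
      using q by auto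
    moreover have "max (Suc p) 2 = Suc p" "max p 2 = p" using \<open>2 \<le> p\<close> by simp_all
    then have "h (Suc p) = fps_X * distinct_fps (Pos - {p})" "h p = fps_X * distinct_fps (Pos - {q})"
      using q by (simp_all add: h_def)
    ultimately show ?thesis using q by (simp add: algebra_simps)
  qed
  moreover have "h (Suc p) - h p = 0" if "\<not> 2 \<le> p" for p
  proof -
    have "max (Suc p) 2 = max p 2" using that by simp
    then show ?thesis by (simp add: h_def)
  qed
  ultimately have "(1 - fps_X) * gap1_fps = fps_Sum (\<lambda>p. h (Suc p) - h p)"
    unfolding gap1_fps_def
    by (subst mult_fps_Sum) (auto simp: X_power_mult_nth_less intro!: arg_cong[of _ _ fps_Sum])
  also have "\<dots> = fps_X * distinct_fps Pos - h 0"
  proof (rule fps_Sum_telescope)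
    fix n
    show "h (Suc n) $ n = (fps_X * distinct_fps Pos) $ n"
    proof (cases "n = 0")
      case False
      then have "distinct_fps (Pos - {n}) $ (n - 1) = distinct_fps Pos $ (n - 1)"
        by (intro distinct_fps_nth_cong) auto
      moreover have "max (Suc n) 2 = Suc n" using False by simp
      ultimately show ?thesis by (simp add: h_def)
    qed (simp add: h_def)
  qed
  also have "h 0 = fps_X * distinct_fps (Pos - {1})" by (simp add: h_def max_def)
  also have G1: "distinct_fps Pos = (1 + fps_X) * distinct_fps (Pos - {1})" using distinct_fps_remove[of 1 Pos] by simp
  also have "fps_X * ((1 + fps_X) * distinct_fps (Pos - {1})) - fps_X * distinct_fps (Pos - {1}) = fps_X ^ 2 * distinct_fps (Pos - {1})"
    by (simp add: algebra_simps power2_eq_square)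
  finally have "(1 + fps_X) * ((1 - fps_X) * gap1_fps) = fps_X ^ 2 * ((1 + fps_X) * distinct_fps (Pos - {1}))"
    by (simp only: mult.left_commute)
  then show ?thesis unfolding G1[symmetric] by (simp add: algebra_simps power2_eq_square)
qed

text \<open>
  The same telescoping with pairs of consecutive forbidden parts: the series of distinct partitions
  avoiding \<open>p\<close> and \<open>p - 1\<close> minus that for \<open>p - 1\<close> and \<open>p - 2\<close> is \<open>X^(p - 2) - X^p\<close> times
  the series of those avoiding all three.
\<close>

lemma gap2_fps_eq: "(1 - fps_X ^ 2) * gap2_fps = fps_X ^ 2 * (distinct_fps Pos - distinct_fps (Pos - {1, 2}))"
proof -
  (* Here h is constant up to 3, and h (Suc n) forbids the parts n and n - 1. *)
  define h where "h p = fps_X ^ 2 * distinct_fps (Pos - {max p 3 - 1, max p 3 - 2})" for p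
  have "(1 - fps_X ^ 2) * (fps_X ^ p * distinct_fps (Pos - {p, p - 1, p - 2})) = h (Suc p) - h p" if "3 \<le> p" for p
  proof -
    obtain q where q: "p = Suc (Suc q)" "q > 0"
      using \<open>3 \<le> p\<close> by (intro that[of "p - 2"]) simp_all
    let ?B = "Pos - {p, p - 1, p - 2}"
    have "distinct_fps (Pos - {p, p - 1}) = (1 + fps_X ^ q) * distinct_fps (Pos - {p, p - 1} - {q})"
      by (rule distinct_fps_remove) (use q in auto)
    moreover have "distinct_fps (Pos - {p - 1, p - 2}) = (1 + fps_X ^ p) * distinct_fps (Pos - {p - 1, p - 2} - {p})"
      by (rule distinct_fps_remove) (use q in auto)
    moreover have "Pos - {p, p - 1} - {q} = ?B" "Pos - {p - 1, p - 2} - {p} = ?B"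
      using q by auto
    moreover have "max (Suc p) 3 = Suc p" "max p 3 = p" using that by simp_all
    then have "h (Suc p) = fps_X ^ 2 * distinct_fps (Pos - {p, p - 1})" "h p = fps_X ^ 2 * distinct_fps (Pos - {p - 1, p - 2})"
      using q by (simp_all add: h_def)
    ultimately show ?thesis using q by (simp add: algebra_simps power2_eq_square)
  qed
  moreover have "h (Suc p) - h p = 0" if "\<not> 3 \<le> p" for p
  proof -
    have "max (Suc p) 3 = max p 3" using that by simp
    then show ?thesis by (simp add: h_def)
  qed
  ultimately have "(1 - fps_X ^ 2) * gap2_fps = fps_Sum (\<lambda>p. h (Suc p) - h p)"
    unfolding gap2_fps_def
    by (subst mult_fps_Sum) (auto simp: X_power_mult_nth_less intro!: arg_cong[of _ _ fps_Sum])
  also have "\<dots> = fps_X ^ 2 * distinct_fps Pos - h 0"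
  proof (rule fps_Sum_telescope)
    fix n
    show "h (Suc n) $ n = (fps_X ^ 2 * distinct_fps Pos) $ n"
    proof (cases "n < 2")
      case False
      then have "distinct_fps (Pos - {n, n - 1}) $ (n - 2) = distinct_fps Pos $ (n - 2)"
        by (intro distinct_fps_nth_cong) auto
      moreover have "max (Suc n) 3 - 1 = n" "max (Suc n) 3 - 2 = n - 1" using False by simp_all
      ultimately show ?thesis using False by (simp add: h_def fps_X_power_mult_nth)
    qed (simp add: h_def fps_X_power_mult_nth)
  qed
  also have "h 0 = fps_X ^ 2 * distinct_fps (Pos - {1, 2})" by (simp add: h_def insert_commute)
  finally show ?thesis by (simp add: algebra_simps)
qed

lemma distinct_hooks_2_fps_gaps: "Abs_fps (\<lambda>n. int (distinct_hooks 2 n)) = gap1_fps"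
proof (rule fps_ext)
  fix n
  have "distinct_hooks 2 n = (\<Sum>lam\<in>distinct_partitions n. card {p \<in> set lam. 2 \<le> p \<and> p - 1 \<notin> set lam})"
    unfolding distinct_hooks_def
  proof (rule sum.cong[OF refl])
    fix lam assume lam: "lam \<in> distinct_partitions n"
    then have "count (mset lam) p \<le> 1" for p
      by (simp add: distinct_partitions_def distinct_count_atmost_1)
    then have "\<not> 2 \<le> count (mset lam) p" for p by (metis Suc_1 not_less_eq_eq One_nat_def)
    then have "{p \<in> set lam. 2 \<le> count (mset lam) p} = {}" by blast
    then show "hook_count 2 lam = card {p \<in> set lam. 2 \<le> p \<and> p - 1 \<notin> set lam}"
      using hook_count_2[of lam n] lam by (simp only: card.empty) (simp add: distinct_partitions_def)
  qed
  also have "\<dots> = (\<Sum>p\<le>n. card {S \<in> subsets_with_sum Pos n. p \<in> S \<and> 2 \<le> p \<and> p - 1 \<notin> S})"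
    by (rule sum_distinct_partitions)
  finally have "int (distinct_hooks 2 n) = (\<Sum>p\<le>n. int (card {S \<in> subsets_with_sum Pos n. p \<in> S \<and> 2 \<le> p \<and> p - 1 \<notin> S}))"
    by simp
  also have "\<dots> = gap1_fps $ n"
    unfolding gap1_fps_def fps_Sum_nth
  proof (rule sum.cong[OF refl])
    fix p
    show "int (card {S \<in> subsets_with_sum Pos n. p \<in> S \<and> 2 \<le> p \<and> p - 1 \<notin> S}) =
        (if 2 \<le> p then fps_X ^ p * distinct_fps (Pos - {p, p - 1}) else 0) $ n"
      using distinct_fps_with_without[of p Pos "{p - 1}" n] by auto
  qed
  finally show "Abs_fps (\<lambda>n. int (distinct_hooks 2 n)) $ n = gap1_fps $ n" by simp
qed

lemma distinct_hooks_2_fps: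
  "Abs_fps (\<lambda>n. int (distinct_hooks 2 n)) = (1 - fps_X) * distinct_fps Pos * Abs_fps (\<lambda>m. int (m div 2))"
proof -
  have *: "((1 - fps_X) * Abs_fps (\<lambda>m. int (m div 2))) $ n = (if even n \<and> n \<noteq> 0 then 1 else 0)" for n
    unfolding one_minus_X_mult_nth by (cases n) (auto simp: div_Suc)
  have "fps_X ^ 2 = (1 - fps_X ^ 2) * ((1 - fps_X) * Abs_fps (\<lambda>m. int (m div 2)))" (is "_ = _ * ?B")
  proof (rule fps_ext)
    fix n
    have "((1 - fps_X ^ 2) * ?B) $ n = ?B $ n - (if n < 2 then 0 else ?B $ (n - 2))"
      unfolding left_diff_distrib[of 1 "fps_X ^ 2" ?B] by (simp only: fps_sub_nth mult_1 fps_X_power_mult_nth)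
    then show "fps_X ^ 2 $ n = ((1 - fps_X ^ 2) * ?B) $ n"
      unfolding * by (auto simp: fps_X_power_nth)
  qed
  then have "(1 - fps_X ^ 2) * gap1_fps = (1 - fps_X ^ 2) * ((1 - fps_X) * distinct_fps Pos * Abs_fps (\<lambda>m. int (m div 2)))"
    unfolding gap1_fps_eq by (simp add: mult_ac)
  then show ?thesis
    using one_minus_X_power_nonzero[of 2] by (simp add: distinct_hooks_2_fps_gaps del: right_minus_eq)
qed

text \<open>
  Arm length 1 requires that \<open>p - 1\<close> is a part. Such pairs are counted as all parts \<open>p \<ge> 2\<close> minus
  those without \<open>p - 1\<close>. Arm length 2 requires that \<open>p - 1\<close> and \<open>p - 2\<close> are missing.
\<close>

lemma distinct_hooks_3_fps_gaps:
  "Abs_fps (\<lambda>n. int (distinct_hooks 3 n)) =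
    fps_Sum (\<lambda>p. if 2 \<le> p then fps_X ^ p * distinct_fps (Pos - {p}) else 0) - gap1_fps + gap2_fps"
proof (rule fps_ext)
  fix n
  let ?A = "\<lambda>S p. 2 \<le> p \<and> p - 1 \<in> S" and ?B = "\<lambda>S p. 3 \<le> p \<and> p - 1 \<notin> S \<and> p - 2 \<notin> S"
  have "distinct_hooks 3 n = (\<Sum>lam\<in>distinct_partitions n. card {p \<in> set lam. ?A (set lam) p}
      + card {p \<in> set lam. ?B (set lam) p})"
    unfolding distinct_hooks_def
  proof (rule sum.cong[OF refl])
    fix lam assume lam: "lam \<in> distinct_partitions n"
    then have c: "count (mset lam) p = (if p \<in> set lam then 1 else 0)" for p
      by (simp add: distinct_partitions_def distinct_count_atmost_1)
    have "{p \<in> set lam. 3 \<le> count (mset lam) p} = {}" using c by auto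
    moreover have "{p \<in> set lam. 2 \<le> p \<and> count (mset lam) (p - 1) \<le> 1 \<and>
        2 \<le> count (mset lam) (p - 1) + count (mset lam) p} = {p \<in> set lam. ?A (set lam) p}"
      unfolding c by auto
    ultimately show "hook_count 3 lam = card {p \<in> set lam. ?A (set lam) p} + card {p \<in> set lam. ?B (set lam) p}"
      using hook_count_3[of lam n] lam by (simp only: card.empty) (simp add: distinct_partitions_def)
  qed
  also have "\<dots> = (\<Sum>p\<le>n. card {S \<in> subsets_with_sum Pos n. p \<in> S \<and> ?A S p} + card {S \<in> subsets_with_sum Pos n. p \<in> S \<and> ?B S p})"
    using sum_distinct_partitions[of ?A n] sum_distinct_partitions[of ?B n] by (simp add: sum.distrib)
  finally have "int (distinct_hooks 3 n) =
      (\<Sum>p\<le>n. int (card {S \<in> subsets_with_sum Pos n. p \<in> S \<and> ?A S p}) + int (card {S \<in> subsets_with_sum Pos n. p \<in> S \<and> ?B S p}))"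
    by simp
  also have "\<dots> = (\<Sum>p\<le>n. (if 2 \<le> p then fps_X ^ p * distinct_fps (Pos - {p}) else 0) $ n
      - (if 2 \<le> p then fps_X ^ p * distinct_fps (Pos - {p, p - 1}) else 0) $ n
      + (if 3 \<le> p then fps_X ^ p * distinct_fps (Pos - {p, p - 1, p - 2}) else 0) $ n)"
  proof (rule sum.cong[OF refl], rule arg_cong2[of _ _ _ _ "(+)"])
    fix p
    show "int (card {S \<in> subsets_with_sum Pos n. p \<in> S \<and> ?A S p}) =
        (if 2 \<le> p then fps_X ^ p * distinct_fps (Pos - {p}) else 0) $ n
      - (if 2 \<le> p then fps_X ^ p * distinct_fps (Pos - {p, p - 1}) else 0) $ n"
    proof (cases "2 \<le> p")
      case True
      have "{S \<in> subsets_with_sum Pos n. p \<in> S \<and> ?A S p} = {S \<in> subsets_with_sum Pos n. p \<in> S \<and> S \<inter> {} = {}} -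
          {S \<in> subsets_with_sum Pos n. p \<in> S \<and> S \<inter> {p - 1} = {}}"
        using True by auto
      moreover have "{S \<in> subsets_with_sum Pos n. p \<in> S \<and> S \<inter> {p - 1} = {}} \<subseteq> {S \<in> subsets_with_sum Pos n. p \<in> S \<and> S \<inter> {} = {}}"
        by auto
      ultimately have "int (card {S \<in> subsets_with_sum Pos n. p \<in> S \<and> ?A S p}) =
          int (card {S \<in> subsets_with_sum Pos n. p \<in> S \<and> S \<inter> {} = {}}) -
          int (card {S \<in> subsets_with_sum Pos n. p \<in> S \<and> S \<inter> {p - 1} = {}})"
        by (simp only: card_Diff_subset finite_subset[OF _ finite_subsets_with_sum[of Pos n]] finite_Collect_conjI
            Collect_conj_eq)
          (simp add: card_Diff_subset card_mono of_nat_diff finite_subsets_with_sum)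
      also have "\<dots> = (fps_X ^ p * distinct_fps (Pos - insert p {})) $ n - (fps_X ^ p * distinct_fps (Pos - insert p {p - 1})) $ n"
        using True by (subst (1 2) distinct_fps_with_without) auto
      finally show ?thesis using True by simp
    next
      case False
      then show ?thesis by auto
    qed
    show "int (card {S \<in> subsets_with_sum Pos n. p \<in> S \<and> ?B S p}) =
        (if 3 \<le> p then fps_X ^ p * distinct_fps (Pos - {p, p - 1, p - 2}) else 0) $ n"
    proof (cases "3 \<le> p")
      case True
      then have "p \<noteq> p - 1" "p \<noteq> p - 2" by linarith+
      then show ?thesis using True distinct_fps_with_without[of p Pos "{p - 1, p - 2}" n] by auto
    qed auto
  qed
  finally show "Abs_fps (\<lambda>n. int (distinct_hooks 3 n)) $ n =
      (fps_Sum (\<lambda>p. if 2 \<le> p then fps_X ^ p * distinct_fps (Pos - {p}) else 0) - gap1_fps + gap2_fps) $ n"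
    by (simp only: fps_nth_Abs_fps gap1_fps_def gap2_fps_def fps_sub_nth fps_add_nth fps_Sum_nth sum_subtractf sum.distrib)
qed

text \<open>
  This is \<open>X^p / ((1 - X) (1 + X^p))\<close> for \<open>p \<ge> 1\<close>.
\<close>

definition odd_quotient_fps :: "nat \<Rightarrow> int fps" where
  "odd_quotient_fps p = Abs_fps (\<lambda>m. if odd (m div p) then 1 else 0)"

text \<open>
  Distinct partitions containing \<open>p\<close> have the series \<open>X^p / (1 + X^p)\<close> times that of all distinct
  partitions.
\<close>

lemma distinct_fps_with_eq:
  assumes "1 \<le> p"
  shows "fps_X ^ p * distinct_fps (Pos - {p}) = (1 - fps_X) * distinct_fps Pos * odd_quotient_fps p"
proof -
  have a: "(1 + fps_X ^ p) * odd_quotient_fps p = fps_X ^ p * Abs_fps (\<lambda>_. 1)"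
  proof (rule fps_ext)
    fix n
    have "((1 + fps_X ^ p) * odd_quotient_fps p) $ n = odd_quotient_fps p $ n + (if n < p then 0 else odd_quotient_fps p $ (n - p))"
      by (simp add: distrib_right fps_X_power_mult_nth)
    also have "\<dots> = (if n < p then 0 else 1)"
    proof (cases "n < p")
      case False
      then have "n div p = Suc ((n - p) div p)" using assms by (simp add: le_div_geq)
      then show ?thesis using False by (simp add: odd_quotient_fps_def)
    qed (simp add: odd_quotient_fps_def)
    finally show "((1 + fps_X ^ p) * odd_quotient_fps p) $ n = (fps_X ^ p * Abs_fps (\<lambda>_. 1)) $ n"
      by (simp add: fps_X_power_mult_nth)
  qed
  have b: "(1 - fps_X) * Abs_fps (\<lambda>_. 1) = (1 :: int fps)"
    by (rule fps_ext) (simp add: one_minus_X_mult_nth)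
  have g: "distinct_fps Pos = (1 + fps_X ^ p) * distinct_fps (Pos - {p})"
    using assms by (intro distinct_fps_remove) auto
  have "(1 - fps_X) * distinct_fps Pos * odd_quotient_fps p = (1 - fps_X) * distinct_fps (Pos - {p}) * ((1 + fps_X ^ p) * odd_quotient_fps p)"
    unfolding g by (simp only: mult_ac)
  also have "\<dots> = fps_X ^ p * distinct_fps (Pos - {p}) * ((1 - fps_X) * Abs_fps (\<lambda>_. 1))"
    unfolding a by (simp only: mult_ac)
  finally show ?thesis unfolding b by simp
qed

text \<open>
  The summand for \<open>p = 0\<close> vanishes because \<open>m div 0 = 0\<close> is even.
\<close>

definition odd_quotients :: "nat \<Rightarrow> int" where
  "odd_quotients m = (\<Sum>p\<le>m. if odd (m div p) then 1 else 0)"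

text \<open>
  The subtracted series is the term for \<open>p = 1\<close>, where \<open>m div p = m\<close>.
\<close>

lemma distinct_fps_parts_ge_2:
  "fps_Sum (\<lambda>p. if 2 \<le> p then fps_X ^ p * distinct_fps (Pos - {p}) else 0) =
    (1 - fps_X) * distinct_fps Pos * (Abs_fps odd_quotients - Abs_fps (\<lambda>m. if odd m then 1 else 0))"
proof -
  have "(if 2 \<le> p then fps_X ^ p * distinct_fps (Pos - {p}) else 0) =
      (1 - fps_X) * distinct_fps Pos * (odd_quotient_fps p - (if p = 1 then odd_quotient_fps 1 else 0))" for p
  proof -
    consider "p = 0" | "p = 1" | "2 \<le> p" by linarith
    then show ?thesis
    proof cases
      case 1
      have "odd_quotient_fps 0 = 0" by (rule fps_ext) (simp add: odd_quotient_fps_def)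
      then show ?thesis using 1 by simp
    next
      case 3
      then show ?thesis using distinct_fps_with_eq[of p] by simp
    qed simp
  qed
  then have "fps_Sum (\<lambda>p. if 2 \<le> p then fps_X ^ p * distinct_fps (Pos - {p}) else 0) =
      (1 - fps_X) * distinct_fps Pos * fps_Sum (\<lambda>p. odd_quotient_fps p - (if p = 1 then odd_quotient_fps 1 else 0))"
    by (simp only:) (rule mult_fps_Sum[symmetric], auto simp: odd_quotient_fps_def)
  also have "fps_Sum (\<lambda>p. odd_quotient_fps p - (if p = 1 then odd_quotient_fps 1 else 0)) =
      Abs_fps odd_quotients - Abs_fps (\<lambda>m. if odd m then 1 else 0)"
  proof (rule fps_ext)
    fix n
    have "(\<Sum>p\<le>n. (if p = 1 then odd_quotient_fps 1 else 0) $ n) = (\<Sum>p\<le>n. if p = 1 then odd_quotient_fps 1 $ n else 0)"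
      by (rule sum.cong) auto
    also have "\<dots> = (if odd n then 1 else 0)"
      by (cases "n = 0") (auto simp: odd_quotient_fps_def)
    finally show "fps_Sum (\<lambda>p. odd_quotient_fps p - (if p = 1 then odd_quotient_fps 1 else 0)) $ n =
      (Abs_fps odd_quotients - Abs_fps (\<lambda>m. if odd m then 1 else 0)) $ n"
      by (simp add: fps_Sum_nth sum_subtractf odd_quotients_def odd_quotient_fps_def)
  qed
  finally show ?thesis .
qed

text \<open>
  The coefficients on the right are those of \<open>X^2 / ((1 - X^2) (1 - X^4))\<close>. With \<open>Y\<close> the series of
  distinct partitions avoiding 1 and 2, the two telescoping identities give
  \<open>(1 - X^2) (gap1_fps - gap2_fps) = X^2 Y\<close>, and
  \<open>(1 - X^4) Y\<close> is \<open>1 - X\<close> times the series of all distinct partitions.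
\<close>

lemma gap1_minus_gap2_fps:
  "gap1_fps - gap2_fps = (1 - fps_X) * distinct_fps Pos * Abs_fps (\<lambda>m. if even m then int ((m + 2) div 4) else 0)"
proof -
  let ?psi = "Abs_fps (\<lambda>m. if even m then int ((m + 2) div 4) else 0)"
  have *: "((1 - fps_X ^ 4) * ?psi) $ n = (if even n \<and> n \<noteq> 0 then 1 else 0)" for n
  proof -
    have "((1 - fps_X ^ 4) * ?psi) $ n = ?psi $ n - (if n < 4 then 0 else ?psi $ (n - 4))"
      by (simp only: left_diff_distrib fps_sub_nth mult_1 fps_X_power_mult_nth)
    also have "\<dots> = (if even n \<and> n \<noteq> 0 then 1 else 0)"
    proof (cases "n < 4")
      case True
      then have "n = 0 \<or> n = 1 \<or> n = 2 \<or> n = 3" by auto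
      then show ?thesis by auto
    next
      case False
      then have "(n + 2) div 4 = Suc ((n - 4 + 2) div 4)" by presburger
      moreover have "even (n - 4) \<longleftrightarrow> even n" "n \<noteq> 0" using False by auto
      ultimately show ?thesis using False by simp
    qed
    finally show ?thesis .
  qed
  have psi: "(1 - fps_X ^ 2) * ((1 - fps_X ^ 4) * ?psi) = fps_X ^ 2" (is "_ * ?B = _")
  proof (rule fps_ext)
    fix n
    have "((1 - fps_X ^ 2) * ?B) $ n = ?B $ n - (if n < 2 then 0 else ?B $ (n - 2))"
      unfolding left_diff_distrib[of 1 "fps_X ^ 2" ?B] by (simp only: fps_sub_nth mult_1 fps_X_power_mult_nth)
    then show "((1 - fps_X ^ 2) * ?B) $ n = fps_X ^ 2 $ n"
      unfolding * by (auto simp: fps_X_power_nth)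
  qed
  define Y where "Y = distinct_fps (Pos - {1, 2})"
  have Y: "distinct_fps Pos = (1 + fps_X) * (1 + fps_X ^ 2) * Y"
  proof -
    have "Pos - {1} - {2} = Pos - {1, 2}" by auto
    then have "distinct_fps (Pos - {1}) = (1 + fps_X ^ 2) * Y" using distinct_fps_remove[of 2 "Pos - {1}"] by (simp add: Y_def)
    then show ?thesis using distinct_fps_remove[of 1 Pos] by (simp add: mult.assoc)
  qed
  have "(1 - fps_X ^ 2) * (gap1_fps - gap2_fps) = fps_X ^ 2 * Y"
    using gap1_fps_eq gap2_fps_eq by (simp add: right_diff_distrib Y_def)
  also have "\<dots> = (1 - fps_X ^ 2) * ((1 - fps_X ^ 4) * ?psi) * Y" by (simp only: psi)
  also have "1 - fps_X ^ 4 = (1 - fps_X) * ((1 + fps_X) * (1 + fps_X ^ 2)) * (1 :: int fps)"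
    by (simp add: algebra_simps power2_eq_square power4_eq_xxxx)
  also have "(1 - fps_X ^ 2) * ((1 - fps_X) * ((1 + fps_X) * (1 + fps_X ^ 2)) * 1 * ?psi) * Y =
      (1 - fps_X ^ 2) * ((1 - fps_X) * distinct_fps Pos * ?psi)"
    unfolding Y by (simp only: mult_ac mult_1)
  finally show ?thesis
    using one_minus_X_power_nonzero[of 2] by (simp del: right_minus_eq)
qed

lemma distinct_hooks_3_fps:
  "Abs_fps (\<lambda>n. int (distinct_hooks 3 n)) = (1 - fps_X) * distinct_fps Pos *
    Abs_fps (\<lambda>m. odd_quotients m - (if odd m then 1 else int ((m + 2) div 4)))"
proof -
  have split: "Abs_fps (\<lambda>m. odd_quotients m - (if odd m then 1 else int ((m + 2) div 4))) =
      Abs_fps odd_quotients - Abs_fps (\<lambda>m. if odd m then 1 else 0)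
        - Abs_fps (\<lambda>m. if even m then int ((m + 2) div 4) else 0)"
    by (rule fps_ext) auto
  have "Abs_fps (\<lambda>n. int (distinct_hooks 3 n)) =
      fps_Sum (\<lambda>p. if 2 \<le> p then fps_X ^ p * distinct_fps (Pos - {p}) else 0) - (gap1_fps - gap2_fps)"
    by (simp only: distinct_hooks_3_fps_gaps) simp
  then show ?thesis
    unfolding split gap1_minus_gap2_fps distinct_fps_parts_ge_2 by (simp only: right_diff_distrib)
qed

section \<open>Lower bounds for the coefficients\<close>

lemma alternating_sum_indicator:
  "(\<Sum>k=1..K. (- 1) ^ (k + 1) * (if k \<le> q then 1 else 0 :: int)) = (if odd (min K q) then 1 else 0)"
proof (induction K)
  case (Suc K)
  show ?case
  proof (cases "Suc K \<le> q")
    case True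
    then have "min (Suc K) q = Suc K" "min K q = K" by simp_all
    then show ?thesis using Suc True by simp
  next
    case False
    then have "min (Suc K) q = q" "min K q = q" by simp_all
    then show ?thesis using Suc False by simp
  qed
qed simp

lemma div_eq_count_quotients_ge:
  fixes m k :: nat
  assumes "1 \<le> k"
  shows "int (m div k) = (\<Sum>p\<le>m. if k \<le> m div p then 1 else 0)"
proof -
  have "{..m} \<inter> {p. k \<le> m div p} = {1..m div k}"
  proof (rule set_eqI)
    fix p
    show "p \<in> {..m} \<inter> {p. k \<le> m div p} \<longleftrightarrow> p \<in> {1..m div k}"
    proof (cases "p = 0")
      case False
      then have "k \<le> m div p \<longleftrightarrow> p \<le> m div k"
        using assms by (simp add: less_eq_div_iff_mult_less_eq mult.commute)
      moreover have "p \<le> m" if "p \<le> m div k" using that div_le_dividend[of m k] by linarith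
      ultimately show ?thesis using False by auto
    qed (use assms in auto)
  qed
  then show ?thesis by (simp add: sum.If_cases)
qed

text \<open>
  The alternating sum of the indicators of \<open>k \<le> q\<close> over \<open>k = 1, \<dots>, K\<close> is 1 if \<open>min K q\<close> is odd
  and 0 otherwise. For odd \<open>K\<close> it therefore bounds the indicator of odd \<open>q\<close> from above.
\<close>

lemma odd_quotients_le:
  assumes "odd K"
  shows "odd_quotients m \<le> (\<Sum>k=1..K. (- 1) ^ (k + 1) * int (m div k))"
proof -
  have "odd_quotients m \<le> (\<Sum>p\<le>m. \<Sum>k=1..K. (- 1) ^ (k + 1) * (if k \<le> m div p then 1 else 0))"
    unfolding odd_quotients_def alternating_sum_indicator
    using assms by (intro sum_mono) (auto simp: min_def)
  also have "\<dots> = (\<Sum>k=1..K. (- 1) ^ (k + 1) * int (m div k))"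
    by (subst sum.swap) (simp add: div_eq_count_quotients_ge sum_distrib_left)
  finally show ?thesis .
qed

text \<open>
  The coefficients of the explicit series for \<open>t = 3\<close>, with the number of odd quotients replaced
  by an upper bound. No shorter truncation suffices: with 13 in place of 15, the number
  \<open>bias_3_5 14\<close> below would drop from 2 to 1, and compensating the negative terms takes 2.
\<close>

definition bias :: "nat \<Rightarrow> int" where
  "bias m = int ((m + 3) div 6) + int ((m - 2) div 4) + int ((m - 1) div 2) - int (m div 4)
    + (if odd m then 1 else int ((m + 2) div 4))
    - (\<Sum>k=1..15. (- 1) ^ (k + 1) * int (m div k))"

lemma bias_expand: "bias m = int ((m + 3) div 6) + int ((m - 2) div 4) + int ((m - 1) div 2) - int (m div 4)
    + (if odd m then 1 else int ((m + 2) div 4))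
    - int m + int (m div 2) - int (m div 3) + int (m div 4) - int (m div 5) + int (m div 6)
    - int (m div 7) + int (m div 8) - int (m div 9) + int (m div 10) - int (m div 11) + int (m div 12)
    - int (m div 13) + int (m div 14) - int (m div 15)"
  unfolding bias_def by (simp add: sum.atLeast_Suc_atMost flip: numeral_2_eq_2)

lemma real_div_bounds:
  assumes "k > 0"
  shows "real (n div k) \<le> real n / real k" "(real n - real k + 1) / real k \<le> real (n div k)"
proof -
  have "k * (n div k) + n mod k = n" "n mod k < k" using assms by auto
  then have *: "real k * real (n div k) + real (n mod k) = real n" "real (n mod k) + 1 \<le> real k"
    by (simp_all flip: of_nat_mult of_nat_add)
  then have "real k * real (n div k) \<le> real n" "real n - real k + 1 \<le> real k * real (n div k)"
    by linarith+
  then show "real (n div k) \<le> real n / real k" "(real n - real k + 1) / real k \<le> real (n div k)"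
    using assms by (simp_all add: field_simps)
qed

text \<open>
  Dropping all roundings, the coefficient of \<open>m\<close> is
  \<open>1/6 + 1/2 - (1 - 1/2 + 1/3 - \<dots> + 1/15) \<approx> -0.0587\<close>, and even \<open>m\<close> contribute \<open>m / 4\<close> in
  addition. The constant 9 covers the rounding errors.
\<close>

lemma bias_lower: "real_of_int (bias m) \<ge> - 6/100 * real m - 9 + (if even m then real m / 4 else 0)"
proof -
  define d where "d k = real (m div k)" for k
  have up: "d k \<le> real m / real k" and low: "(real m - real k + 1) / real k \<le> d k" if "k > 0" for k
    using real_div_bounds[OF that] by (simp_all add: d_def)
  define a b e c where "a = real ((m - 1) div 2)" and "b = real ((m + 3) div 6)"
    and "e = real ((m - 2) div 4)"
    and "c = (if odd m then 1 else real ((m + 2) div 4))"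
  define h where "h = (if even m then real m / 4 else 0)"
  have A: "a \<ge> real m / 2 - 1"
    using real_div_bounds(2)[of 2 "m - 1"] by (cases m) (auto simp: a_def)
  have B: "b \<ge> real m / 6 - 1 / 3"
    using real_div_bounds(2)[of 6 "m + 3"] by (simp add: b_def)
  have C: "c \<ge> h - 1/4"
    using real_div_bounds(2)[of 4 "m + 2"] by (auto simp: c_def h_def)
  have "m div 4 \<le> (m - 2) div 4 + 1" by presburger
  then have E: "d 4 \<le> e + 1" unfolding d_def e_def by linarith
  note D = up[of 3] up[of 5] up[of 7] up[of 9] up[of 11] up[of 13] up[of 15]
    low[of 2] low[of 4] low[of 6] low[of 8] low[of 10] low[of 12] low[of 14]
  have "real_of_int (bias m) = b + e + a - d 4 + c - real m + d 2 - d 3 + d 4 - d 5 + d 6 - d 7 + d 8 - d 9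
    + d 10 - d 11 + d 12 - d 13 + d 14 - d 15"
    unfolding bias_expand a_def b_def c_def d_def e_def by simp
  then have "real_of_int (bias m) \<ge> - 6/100 * real m - 9 + h"
    using A B C D E by simp
  then show ?thesis by (simp add: h_def)
qed

text \<open>
  Exactly one of \<open>m\<close> and \<open>m - 3\<close> is even, so one term \<open>m / 4\<close> outweighs the two negative slopes.
\<close>

lemma bias_pair_lower:
  assumes "m \<ge> 3"
  shows "real_of_int (bias m + bias (m - 3)) \<ge> 13 / 100 * real m - 19"
proof -
  have "even (m - 3) \<longleftrightarrow> odd m" using assms by simp
  then show ?thesis using bias_lower[of m] bias_lower[of "m - 3"] assms
    by (cases "even m") (simp_all add: of_nat_diff field_simps)
qed

text \<open>
  The linear bound is nonnegative from 147 on; the smaller cases are computed.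
\<close>

lemma bias_pair_small: "list_all (\<lambda>m. bias m + bias (m - 3) \<ge> 0) [8..<150]"
  unfolding bias_expand by (simp add: upt_rec)

lemma bias_pair_nonneg:
  assumes "m \<ge> 8"
  shows "bias m + bias (m - 3) \<ge> 0"
proof (cases "m < 150")
  case True
  then have "m \<in> set [8..<150]" using assms by (simp only: set_upt atLeastLessThan_iff)
  then show ?thesis using bias_pair_small by (simp only: list_all_iff)
next
  case False
  then have "0 \<le> real_of_int (bias m + bias (m - 3))" using bias_pair_lower[of m] by simp
  then show ?thesis by (simp only: of_int_0_le_iff)
qed

text \<open>
  The coefficients of \<open>1 / (1 - X^k)\<close> times the series with coefficients \<open>f\<close>.
\<close>

fun stride_sum :: "nat \<Rightarrow> (nat \<Rightarrow> int) \<Rightarrow> nat \<Rightarrow> int" where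
  "stride_sum k f m = f m + (if k = 0 \<or> m < k then 0 else stride_sum k f (m - k))"

declare stride_sum.simps [simp del]

lemma stride_sum_fps:
  assumes "k > 0"
  shows "(1 - fps_X ^ k) * Abs_fps (stride_sum k f) = Abs_fps f"
proof (rule fps_ext)
  fix n
  have "((1 - fps_X ^ k) * Abs_fps (stride_sum k f)) $ n =
      stride_sum k f n - (if n < k then 0 else stride_sum k f (n - k))"
    by (simp add: left_diff_distrib fps_X_power_mult_nth)
  then show "((1 - fps_X ^ k) * Abs_fps (stride_sum k f)) $ n = Abs_fps f $ n"
    using assms stride_sum.simps[of k f n] by simp
qed

definition bias_3 :: "nat \<Rightarrow> int" where "bias_3 = stride_sum 3 bias"
definition bias_3_5 :: "nat \<Rightarrow> int" where "bias_3_5 = stride_sum 5 bias_3"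

lemma bias_3_rec: "bias_3 m = bias m + (if m < 3 then 0 else bias_3 (m - 3))"
  using stride_sum.simps[of 3 bias m] by (simp add: bias_3_def)

lemma bias_3_5_rec: "bias_3_5 m = bias_3 m + (if m < 5 then 0 else bias_3_5 (m - 5))"
  using stride_sum.simps[of 5 bias_3 m] by (simp add: bias_3_5_def)

text \<open>
  Small coefficients, up to the point where the recursions in steps of 6 and 5 take over.
\<close>

lemma bias_table:
  "bias 0 = 0"
  "bias (Suc 0) = 0"
  "bias 2 = 0"
  "bias 3 = 0"
  "bias 4 = 0"
  "bias 5 = -1"
  "bias 6 = 1"
  "bias 7 = -1"
  "bias 8 = 1"
  "bias 9 = -1"
  "bias 10 = 2"
  "bias 11 = -1"
  "bias 12 = 2"
  "bias 13 = -1"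
  "bias 14 = 3"
  "bias 15 = -2"
  "bias 16 = 2"
  "bias 17 = -1"
  "bias 18 = 3"
  "bias 19 = -1"
  "bias 20 = 3"
  "bias 21 = -2"
  by (simp_all add: bias_expand)

lemma bias_3_table:
  "bias_3 0 = 0"
  "bias_3 (Suc 0) = 0"
  "bias_3 2 = 0"
  "bias_3 3 = 0"
  "bias_3 4 = 0"
  "bias_3 5 = -1"
  "bias_3 6 = 1"
  "bias_3 7 = -1"
  "bias_3 8 = 0"
  "bias_3 9 = 0"
  "bias_3 10 = 1"
  "bias_3 11 = -1"
  "bias_3 12 = 2"
  "bias_3 13 = 0"
  "bias_3 14 = 2"
  "bias_3 15 = 0"
  "bias_3 16 = 2"
  "bias_3 17 = 1"
  "bias_3 18 = 3"
  "bias_3 19 = 1"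
  "bias_3 20 = 4"
  "bias_3 21 = 1"
  by (simp_all add: bias_3_rec bias_table)

lemma bias_3_5_table:
  "bias_3_5 0 = 0"
  "bias_3_5 (Suc 0) = 0"
  "bias_3_5 2 = 0"
  "bias_3_5 3 = 0"
  "bias_3_5 4 = 0"
  "bias_3_5 5 = -1"
  "bias_3_5 6 = 1"
  "bias_3_5 7 = -1"
  "bias_3_5 8 = 0"
  "bias_3_5 9 = 0"
  "bias_3_5 10 = 0"
  "bias_3_5 11 = 0"
  "bias_3_5 12 = 1"
  "bias_3_5 13 = 0"
  "bias_3_5 14 = 2"
  "bias_3_5 15 = 0"
  "bias_3_5 16 = 2"
  "bias_3_5 17 = 2"
  "bias_3_5 18 = 3"
  "bias_3_5 19 = 3"
  "bias_3_5 20 = 4"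
  "bias_3_5 21 = 3"
  by (simp_all add: bias_3_5_rec bias_3_table)

lemma bias_3_rec_6:
  assumes "6 \<le> m"
  shows "bias_3 m = bias m + bias (m - 3) + bias_3 (m - 6)"
proof -
  have "\<not> m < 3" "\<not> m - 3 < 3" "m - 3 - 3 = m - 6" using assms by linarith+
  then show ?thesis using bias_3_rec[of m] bias_3_rec[of "m - 3"] by simp
qed

lemma bias_3_nonneg: "12 \<le> m \<Longrightarrow> 0 \<le> bias_3 m"
proof (induction m rule: less_induct)
  case (less m)
  show ?case
  proof (cases "m < 18")
    case True
    then have "m = 12 \<or> m = 13 \<or> m = 14 \<or> m = 15 \<or> m = 16 \<or> m = 17" using less.prems by presburger
    then show ?thesis by (auto simp: bias_3_table)
  next
    case False
    then have "12 \<le> m - 6" by linarith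
    then show ?thesis using False bias_3_rec_6[of m] less.IH[of "m - 6"] bias_pair_nonneg[of m] by simp
  qed
qed

lemma bias_3_5_ge_2: "16 \<le> m \<Longrightarrow> 2 \<le> bias_3_5 m"
proof (induction m rule: less_induct)
  case (less m)
  show ?case
  proof (cases "m < 22")
    case True
    then have "m = 16 \<or> m = 17 \<or> m = 18 \<or> m = 19 \<or> m = 20 \<or> m = 21" using less.prems by presburger
    then show ?thesis by (auto simp: bias_3_5_table)
  next
    case False
    then have "16 \<le> m - 5" by linarith
    then show ?thesis using False bias_3_5_rec[of m] less.IH[of "m - 5"] bias_3_nonneg[of m] by simp
  qed
qed

text \<open>
  Transfers the linear growth of the pair sums to \<open>bias_3_5\<close>; the summand 2 makes up for the loss
  in the final comparison.
\<close>

lemma bias_3_5_ge_pair: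
  assumes "22 \<le> m"
  shows "bias m + bias (m - 3) + 2 \<le> bias_3_5 m"
proof -
  have "12 \<le> m - 6" "16 \<le> m - 5" using assms by linarith+
  then show ?thesis using assms bias_3_5_rec[of m] bias_3_rec_6[of m] bias_3_nonneg[of "m - 6"] bias_3_5_ge_2[of "m - 5"] by simp
qed

section \<open>Comparison of the two totals\<close>

lemma partition_fps_nonneg: "0 \<le> partition_fps A $ n"
  by (simp add: partition_fps_def)

lemma partition_fps_nth_0: "0 \<notin> A \<Longrightarrow> partition_fps A $ 0 = 1"
proof -
  assume "0 \<notin> A"
  then have "partition_fps A $ 0 = partition_fps {} $ 0" by (intro partition_fps_nth_cong) auto
  then show ?thesis by (simp add: partition_fps_empty)
qed

text \<open>
  Every nonempty partition arises by adding a part to a smaller one.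
\<close>

lemma partition_fps_nth_le_remove_part:
  assumes "0 \<notin> A" "n > 0"
  shows "partition_fps A $ n \<le> (Abs_fps (\<lambda>k. if k \<in> A then 1 else 0) * partition_fps A) $ n"
proof -
  have "parts_in A n \<subseteq> (\<Union>p\<in>A \<inter> {..n}. add_mset p ` parts_in A (n - p))"
  proof
    fix M assume M: "M \<in> parts_in A n"
    then have "M \<noteq> {#}" using assms by (auto simp: parts_in_def)
    then obtain p N where "M = add_mset p N" by (meson multiset_cases)
    moreover from this have "p \<in> A \<inter> {..n}" "N \<in> parts_in A (n - p)" using M by (auto simp: parts_in_def)
    ultimately show "M \<in> (\<Union>p\<in>A \<inter> {..n}. add_mset p ` parts_in A (n - p))" by blast
  qed
  moreover have "finite (\<Union>p\<in>A \<inter> {..n}. add_mset p ` parts_in A (n - p))"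
    using finite_parts_in[OF assms(1)] by blast
  ultimately have "card (parts_in A n) \<le> card (\<Union>p\<in>A \<inter> {..n}. add_mset p ` parts_in A (n - p))"
    by (rule card_mono[rotated])
  also have "\<dots> \<le> (\<Sum>p\<in>A \<inter> {..n}. card (add_mset p ` parts_in A (n - p)))"
    by (rule card_UN_le) simp
  also have "\<dots> \<le> (\<Sum>p\<in>A \<inter> {..n}. card (parts_in A (n - p)))"
    by (intro sum_mono card_image_le finite_parts_in assms(1))
  also have "\<dots> = (\<Sum>p\<le>n. if p \<in> A then card (parts_in A (n - p)) else 0)"
    by (simp add: sum.If_cases Int_commute)
  finally have "int (card (parts_in A n)) \<le> (\<Sum>p\<le>n. if p \<in> A then int (card (parts_in A (n - p))) else 0)"
    by (subst (asm) of_nat_le_iff[symmetric, where 'a = int]) (simp add: if_distrib cong: if_cong)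
  also have "\<dots> = (Abs_fps (\<lambda>k. if k \<in> A then 1 else 0) * partition_fps A) $ n"
    by (simp add: fps_mult_nth partition_fps_def atLeast0AtMost if_distrib[of "\<lambda>c. c * _"] cong: if_cong)
  finally show ?thesis by (simp add: partition_fps_def)
qed

lemma fps_mult_nth_ge:
  fixes f g :: "int fps"
  assumes "\<And>n. 0 \<le> f $ n" "\<And>n. 0 \<le> g $ n"
  shows "f $ 0 * g $ n \<le> (f * g) $ n"
proof -
  have "f $ 0 * g $ (n - 0) \<le> (\<Sum>i=0..n. f $ i * g $ (n - i))"
    by (rule member_le_sum[of 0 "{0..n}" "\<lambda>i. f $ i * g $ (n - i)"]) (auto simp: assms)
  then show ?thesis by (simp add: fps_mult_nth)
qed

lemma fps_mult_nth_mono: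
  fixes f g h :: "int fps"
  assumes "\<And>n. 0 \<le> f $ n" "\<And>n. g $ n \<le> h $ n"
  shows "(f * g) $ n \<le> (f * h) $ n"
  unfolding fps_mult_nth by (intro sum_mono mult_left_mono assms)

lemma filterlim_int_at_top_of_linear_bound:
  fixes f :: "nat \<Rightarrow> int"
  assumes "c > 0" "\<And>n. n \<ge> n0 \<Longrightarrow> c * real n - d \<le> real_of_int (f n)"
  shows "filterlim f at_top sequentially"
  unfolding filterlim_at_top
proof
  fix Z :: int
  obtain N :: nat where N: "(real_of_int Z + d) / c \<le> real N" using real_arch_simple by blast
  show "eventually (\<lambda>n. Z \<le> f n) sequentially"
  proof (rule eventually_sequentiallyI[of "max N n0"])
    fix n assume n: "max N n0 \<le> n"
    then have "(real_of_int Z + d) / c \<le> real n" using N by simp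
    then have "real_of_int Z \<le> c * real n - d" using assms(1) by (simp add: field_simps)
    also have "\<dots> \<le> real_of_int (f n)" using n assms(2) by simp
    finally show "Z \<le> f n" by simp
  qed
qed

lemma partition_fps_without_1: "(1 - fps_X) * partition_fps Odd = partition_fps (Odd - {1})"
  using partition_fps_remove[of 1 Odd] by simp

lemma hooks_2_diff_ge:
  assumes "n \<ge> 1"
  shows "real n / 4 - 3 \<le> real_of_int (int (odd_hooks 2 n) - int (distinct_hooks 2 n))"
proof -
  define f where "f m = int ((m + 2) div 4) + int ((m - 1) div 2) - int (m div 2)" for m
  have f: "0 \<le> f m" "int m \<le> 4 * (f m + 2)" for m
  proof -
    define a b c where "a = (m + 2) div 4" and "b = (m - 1) div 2" and "c = m div 2"
    have 1: "c \<le> b + 1" "m \<le> 4 * a + 2" unfolding a_def b_def c_def by presburger+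
    have 2: "c \<le> b + a"
    proof (cases "m < 2")
      case True
      then show ?thesis by (simp add: c_def)
    next
      case False
      then have "1 \<le> a" unfolding a_def by presburger
      then show ?thesis using 1 by linarith
    qed
    have "f m = int a + int b - int c" by (simp add: f_def a_def b_def c_def)
    moreover have "int m \<le> int (4 * a + 2)" using 1(2) by (simp only: of_nat_le_iff)
    ultimately show "0 \<le> f m" "int m \<le> 4 * (f m + 2)" using 1(1) 2 by simp_all
  qed
  have "Abs_fps (\<lambda>n. int (odd_hooks 2 n)) - Abs_fps (\<lambda>n. int (distinct_hooks 2 n)) = partition_fps (Odd - {1}) * Abs_fps f"
  proof -
    have "Abs_fps f = Abs_fps (\<lambda>m. int ((m + 2) div 4) + int ((m - 1) div 2)) - Abs_fps (\<lambda>m. int (m div 2))"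
      by (rule fps_ext) (simp add: f_def)
    then show ?thesis
      by (simp only: odd_hooks_2_fps distinct_hooks_2_fps euler_odd_distinct[symmetric] partition_fps_without_1[symmetric] right_diff_distrib)
  qed
  then have "int (odd_hooks 2 n) - int (distinct_hooks 2 n) = (partition_fps (Odd - {1}) * Abs_fps f) $ n"
    by (metis fps_nth_Abs_fps fps_sub_nth)
  also have "\<dots> \<ge> partition_fps (Odd - {1}) $ 0 * Abs_fps f $ n"
    by (rule fps_mult_nth_ge) (simp_all add: partition_fps_nonneg f)
  finally have "f n \<le> int (odd_hooks 2 n) - int (distinct_hooks 2 n)" by (simp add: partition_fps_nth_0)
  then have "int n \<le> 4 * (int (odd_hooks 2 n) - int (distinct_hooks 2 n) + 2)" using f(2)[of n] by simp
  then have "real_of_int (int n) \<le> real_of_int (4 * (int (odd_hooks 2 n) - int (distinct_hooks 2 n) + 2))"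
    by (simp only: of_int_le_iff)
  then show ?thesis by simp
qed

text \<open>
  Let \<open>E\<close> be the series of partitions into odd parts \<open>\<ge> 7\<close> and \<open>H\<close> the sum of \<open>X^k\<close> over these
  \<open>k\<close>. Removing a part shows that \<open>R = E - H E\<close> has no positive coefficient except the constant one.
  Hence the negative terms \<open>- (X^5 + X^7) E\<close> of the product may be replaced by
  \<open>- (X^5 + X^7) H E\<close> at the cost of constants in degrees 5 and 7 only. This changes \<open>bias_3_5\<close>
  into the series \<open>z\<close>, which has no negative coefficient and is at least \<open>bias_3_5 - 2\<close> from 8 on.
\<close>

lemma hooks_3_diff_ge:
  assumes "n \<ge> 22"
  shows "13 / 100 * real n - 19 \<le> real_of_int (int (odd_hooks 3 n) - int (distinct_hooks 3 n))"
proof -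
  define f where "f m = int ((m + 3) div 6) + int ((m - 2) div 4) + int ((m - 1) div 2) - int (m div 4)
      - (odd_quotients m - (if odd m then 1 else int ((m + 2) div 4)))" for m
  have bias_le_f: "bias m \<le> f m" for m
    using odd_quotients_le[of 15 m] by (simp add: bias_def f_def)
  have "Abs_fps (\<lambda>n. int (odd_hooks 3 n)) - Abs_fps (\<lambda>n. int (distinct_hooks 3 n)) = partition_fps (Odd - {1}) * Abs_fps f"
  proof -
    have "Abs_fps f = Abs_fps (\<lambda>m. int ((m + 3) div 6) + int ((m - 2) div 4) + int ((m - 1) div 2) - int (m div 4))
        - Abs_fps (\<lambda>m. odd_quotients m - (if odd m then 1 else int ((m + 2) div 4)))"
      by (rule fps_ext) (simp add: f_def)
    then show ?thesis
      by (simp only: odd_hooks_3_fps distinct_hooks_3_fps euler_odd_distinct[symmetric] partition_fps_without_1[symmetric] right_diff_distrib)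
  qed
  then have "int (odd_hooks 3 n) - int (distinct_hooks 3 n) = (partition_fps (Odd - {1}) * Abs_fps f) $ n"
    by (metis fps_nth_Abs_fps fps_sub_nth)
  also have "\<dots> \<ge> (partition_fps (Odd - {1}) * Abs_fps bias) $ n"
    by (rule fps_mult_nth_mono) (simp_all add: partition_fps_nonneg bias_le_f)
  finally have 1: "(partition_fps (Odd - {1}) * Abs_fps bias) $ n \<le> int (odd_hooks 3 n) - int (distinct_hooks 3 n)" .
  define E where "E = partition_fps (Odd - {1} - {3} - {5})"
  have E_eq: "E = (1 - fps_X ^ 5) * ((1 - fps_X ^ 3) * partition_fps (Odd - {1}))"
    unfolding E_def by (subst partition_fps_remove, simp, simp)+ simp
  have "partition_fps (Odd - {1}) * Abs_fps bias = partition_fps (Odd - {1}) * ((1 - fps_X ^ 3) * ((1 - fps_X ^ 5) * Abs_fps bias_3_5))"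
    unfolding bias_3_5_def stride_sum_fps[OF zero_less_numeral] bias_3_def ..
  also have "\<dots> = E * Abs_fps bias_3_5" unfolding E_eq by (simp only: mult_ac)
  finally have 2: "partition_fps (Odd - {1}) * Abs_fps bias = E * Abs_fps bias_3_5" .
  define H where "H = Abs_fps (\<lambda>k. if k \<in> Odd - {1} - {3} - {5} then 1 else (0 :: int))"
  define R where "R = E - H * E"
  have R: "R $ m \<le> 0" if "m > 0" for m
    using partition_fps_nth_le_remove_part[of "Odd - {1} - {3} - {5}" m] that by (simp add: R_def H_def E_def)
  define z where "z = Abs_fps bias_3_5 + (fps_X ^ 5 + fps_X ^ 7) * (1 - H)"
  have z: "z $ m = bias_3_5 m + (if m < 5 then 0 else (1 - H) $ (m - 5)) + (if m < 7 then 0 else (1 - H) $ (m - 7))" for m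
    unfolding z_def by (simp only: distrib_right fps_add_nth fps_X_power_mult_nth fps_nth_Abs_fps add.assoc)
  have z_ge: "bias_3_5 m - 2 \<le> z $ m" if "m \<ge> 8" for m
    using that unfolding z by (simp add: H_def)
  have z_nonneg: "0 \<le> z $ m" for m
  proof (cases "m < 16")
    case True
    then have "m = 0 \<or> m = 1 \<or> m = 2 \<or> m = 3 \<or> m = 4 \<or> m = 5 \<or> m = 6 \<or> m = 7 \<or> m = 8 \<or> m = 9 \<or> m = 10
      \<or> m = 11 \<or> m = 12 \<or> m = 13 \<or> m = 14 \<or> m = 15" by presburger
    then show ?thesis unfolding z by (elim disjE) (simp_all add: bias_3_5_table H_def)
  next
    case False
    then show ?thesis using z_ge[of m] bias_3_5_ge_2[of m] by simp
  qed
  have "E * z = E * Abs_fps bias_3_5 + (fps_X ^ 5 * R + fps_X ^ 7 * R)"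
    by (simp add: z_def R_def algebra_simps)
  then have "(E * z) $ n = (E * Abs_fps bias_3_5) $ n + (R $ (n - 5) + R $ (n - 7))"
    using assms by (simp add: fps_X_power_mult_nth)
  moreover have "R $ (n - 5) \<le> 0" "R $ (n - 7) \<le> 0" using R assms by simp_all
  moreover have "E $ 0 * z $ n \<le> (E * z) $ n"
    by (rule fps_mult_nth_ge) (simp_all add: E_def partition_fps_nonneg z_nonneg)
  moreover have "E $ 0 = 1" by (simp add: E_def partition_fps_nth_0)
  ultimately have "bias_3_5 n - 2 \<le> (E * Abs_fps bias_3_5) $ n" using z_ge[of n] assms by simp
  then have "bias n + bias (n - 3) \<le> int (odd_hooks 3 n) - int (distinct_hooks 3 n)"
    using 1 2 bias_3_5_ge_pair[OF assms] by simp
  then have "real_of_int (bias n + bias (n - 3)) \<le> real_of_int (int (odd_hooks 3 n) - int (distinct_hooks 3 n))"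
    by (simp only: of_int_le_iff)
  then show ?thesis using bias_pair_lower[of n] assms by linarith
qed

theorem theorem1p9:
  fixes t :: nat
  assumes "t \<in> {2, 3}"
  shows "filterlim (\<lambda>n. int (odd_hooks t n) - int (distinct_hooks t n)) at_top sequentially"
proof -
  consider "t = 2" | "t = 3" using assms by blast
  then show ?thesis
  proof cases
    case 1
    show ?thesis unfolding 1
      by (rule filterlim_int_at_top_of_linear_bound[of "1 / 4" 1 3]) (use hooks_2_diff_ge in simp_all)
  next
    case 2
    show ?thesis unfolding 2
      by (rule filterlim_int_at_top_of_linear_bound[of "13 / 100" 22 19]) (use hooks_3_diff_ge in simp_all)
  qed
qed

end
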